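(* Let $n \geq 2$ be an integer and $s>0$. Suppose there is a constant $C_s$ such that for every Schwartz function $f$ on $\mathbb{R}^n$, \[ \Big\| \sup_{0<t<1} |(e^{it\Delta} f)(x)| \Big\|_{L^1(B_n(0,1), dx)} \leq C_s \|f\|_{H^s(\mathbb{R}^n)}. \] Then $s \geq \frac{n}{2(n+1)}$.
   Context: Fourier transform convention: $\hat{f}(\xi) = \int_{\mathbb{R}^n} f(x) e^{-i x\cdot \xi}\,dx$. For a Schwartz function $f$ on $\mathbb{R}^n$ and $t \in \mathbb{R}$, \[ (e^{it\Delta} f)(x) = \frac{1}{(2\pi)^n} \int_{\mathbb{R}^n} \hat{f}(\xi) e^{i(\xi\cdot x + |\xi|^2 t)}\,d\xi. \] The Sobolev norm is $\|f\|_{H^s(\mathbb{R}^n)}^2 = (2\pi)^{-n} \int_{\mathbb{R}^n} (1+|\xi|^2)^{s} |\hat{f}(\xi)|^2\,d\xi$. $B_n(0,1)$ denotes the Euclidean unit ball in $\mathbb{R}^n$ centered at the origin. *)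

theory Defs
  imports "HOL-Analysis.Analysis"
begin

definition dir_deriv :: "real^'n::finite \<Rightarrow> (real^'n \<Rightarrow> complex) \<Rightarrow> real^'n \<Rightarrow> complex" where
  "dir_deriv v f x = frechet_derivative f (at x) v"

fun iter_dir_deriv :: "(real^('n::finite)) list \<Rightarrow> (real^'n \<Rightarrow> complex) \<Rightarrow> real^'n \<Rightarrow> complex" where
  "iter_dir_deriv [] f = f"
| "iter_dir_deriv (v # vs) f = dir_deriv v (iter_dir_deriv vs f)"

definition schwartz :: "(real^'n::finite \<Rightarrow> complex) set" where
  "schwartz = {f. \<forall>vs. (\<forall>x. iter_dir_deriv vs f differentiable (at x)) \<and>
       (\<forall>N::nat. \<exists>C. \<forall>x. (1 + norm x) ^ N * norm (iter_dir_deriv vs f x) \<le> C)}"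

definition fourier :: "(real^'n::finite \<Rightarrow> complex) \<Rightarrow> real^'n \<Rightarrow> complex" where
  "fourier f \<xi> = (LINT x|lborel. f x * exp (- \<i> * complex_of_real (x \<bullet> \<xi>)))"

definition schroedinger :: "real \<Rightarrow> (real^'n::finite \<Rightarrow> complex) \<Rightarrow> real^'n \<Rightarrow> complex" where
  "schroedinger t f x = complex_of_real (1 / (2 * pi) ^ CARD('n)) *
     (LINT \<xi>|lborel. fourier f \<xi> * exp (\<i> * complex_of_real (\<xi> \<bullet> x + (norm \<xi>)\<^sup>2 * t)))"

definition sobolev_norm :: "real \<Rightarrow> (real^'n::finite \<Rightarrow> complex) \<Rightarrow> real" where
  "sobolev_norm s f = sqrt ((1 / (2 * pi) ^ CARD('n)) *
     (LINT \<xi>|lborel. (1 + (norm \<xi>)\<^sup>2) powr s * (cmod (fourier f \<xi>))\<^sup>2))"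

text \<open>L^1(B_n(0,1)) norm of the maximal function sup_{0<t<1} |e^{it\<Delta>} f|, as an
  extended nonnegative integral (no integrability side condition needed).\<close>
definition max_L1_ball :: "(real^'n::finite \<Rightarrow> complex) \<Rightarrow> ennreal" where
  "max_L1_ball f = (\<integral>\<^sup>+ x. (SUP t\<in>{0<..<1}. ennreal (cmod (schroedinger t f x)))
        * indicator (ball 0 1) x \<partial>lborel)"

end

theory Submission
  imports Defs "HOL-Probability.Probability" "HOL-Number_Theory.Number_Theory"
    "HOL-Real_Asymp.Real_Asymp"
begin

text \<open>
  This is Bourgain's counterexample, with Gaussian envelopes so that everything reduces to
  one-dimensional integrals. Let \<open>k = n - 1\<close> and let \<open>T\<close> be a large integer. The initial datum is a
  product: in one distinguished coordinate a Gaussian of width \<open>1 / T ^ (n + 1)\<close> with frequency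
  \<open>- 2 pi T ^ (2 n + 2)\<close>, in each of the other \<open>k\<close> coordinates a unit Gaussian times a sum of about
  \<open>T ^ n\<close> exponentials with frequencies in \<open>2 pi T ^ (n + 2)\<close> times the integers. Take a time of
  the form \<open>t = p / (8 pi q T ^ (2 n + 4))\<close> with \<open>q \<le> T ^ k\<close> and \<open>p\<close> coprime to \<open>4 q\<close>. The first
  factor travels to \<open>p / (2 q T^2)\<close>, and when \<open>T ^ (n + 2) * x $ j\<close> is within \<open>1 / (q T)\<close> of
  \<open>a j / q\<close> the other factors become slowly modulated quadratic Gauss sums modulo \<open>4 q\<close>, of
  size about \<open>T ^ n / sqrt q\<close>. By Dirichlet's simultaneous approximation theorem most
  transversal positions admit such a \<open>q\<close> of size about \<open>T ^ k\<close>, and the density of admissible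
  \<open>p\<close> is at least \<open>1 / log T\<close>. So the maximal function is of size \<open>T ^ ((n^2 - 1) / 2)\<close> on a set of
  measure at least a constant times \<open>1 / log T\<close>, whereas the Sobolev norm is at most a constant times
  \<open>T ^ ((2 n + 2) s + (n^2 - 2 n - 1) / 2)\<close>. Letting \<open>T\<close> grow forces \<open>(2 n + 2) s \<ge> n\<close>.
\<close>

section \<open>Product integrals over Euclidean space\<close>

text \<open>The powers of \<open>T\<close> are tuned to one another. A longitudinal velocity of
  order \<open>T ^ (2 n + 2)\<close> confines the useful times to the inverse order, and
  \<open>T ^ (n + 1)\<close> is the largest frequency spread that does not disperse in such a time.
  Transversal frequencies also stop near \<open>T ^ (2 n + 2)\<close>, so they do not raise the
  frequency scale of the Sobolev norm. Since the supremum allows a separate time for each point, the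
  longitudinal coordinate selects the time, and the transversal ones only have to be approximable
  with denominator \<open>q\<close>. Arrival points for one \<open>q\<close> are at least
  \<open>1 / (2 q T^2)\<close> apart; for \<open>q\<close> near \<open>T ^ k\<close> this is
  comparable with the width of the Gaussian, so the translates stay disjoint and yet fill a fixed
  share of an interval, up to the loss from coprimality. About \<open>T ^ n\<close> terms with
  period at most \<open>4 T ^ k\<close> make at least of order \<open>T\<close> periods, room enough
  for the logarithmic error of an incomplete last period. The other logarithm, from the density of
  coprime numerators, is harmless because the negated conclusion leaves a positive power of
  \<open>T\<close>.\<close>

lemma prod_Basis_vec:
  fixes g :: "real^'n \<Rightarrow> 'a::comm_monoid_mult"
  shows "(\<Prod>b\<in>Basis. g b) = (\<Prod>i\<in>UNIV. g (axis i 1))"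
proof -
  have B: "(Basis :: (real^'n) set) = (\<lambda>i. axis i 1) ` UNIV"
    by (auto simp: Basis_vec_def)
  have "inj (\<lambda>i::'n. axis i (1::real))"
    by (auto simp: inj_on_def axis_eq_axis)
  then show ?thesis
    unfolding B by (subst prod.reindex) auto
qed

lemma nn_integral_vec_prod:
  fixes f :: "'n::finite \<Rightarrow> real \<Rightarrow> ennreal"
  assumes [measurable]: "\<And>i. f i \<in> borel_measurable borel"
  shows "(\<integral>\<^sup>+x. (\<Prod>i\<in>UNIV. f i (x $ i)) \<partial>(lborel::(real^'n) measure)) = (\<Prod>i\<in>UNIV. \<integral>\<^sup>+x. f i x \<partial>lborel)"
proof -
  \<comment> \<open>The product formula is indexed by basis vectors; this description recovers the
    coordinate index from a basis vector.\<close>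
  have inj: "(THE j. axis i (1::real) = axis j 1) = i" for i :: 'n
    by (rule the_equality) (auto simp: axis_eq_axis)
  have "(\<integral>\<^sup>+x. (\<Prod>b\<in>(Basis::(real^'n) set). f (THE j. b = axis j 1) (x \<bullet> b)) \<partial>lborel)
      = (\<Prod>b\<in>(Basis::(real^'n) set). \<integral>\<^sup>+x. f (THE j. b = axis j 1) x \<partial>lborel)"
    by (rule nn_integral_lborel_prod) auto
  then show ?thesis
    unfolding prod_Basis_vec inj by (simp add: inner_axis)
qed

text \<open>Complex integrands need the Bochner integral, so \<open>lborel\<close> is written as the
  image of a product measure under \<open>?s\<close> and the product formula is applied there. The
  form \<open>has_bochner_integral\<close> delivers integrability together with the value.\<close>

lemma has_bochner_integral_vec_prod:
  fixes f :: "'n::finite \<Rightarrow> real \<Rightarrow> 'b::{real_normed_field,banach,second_countable_topology}"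
  assumes f: "\<And>i. integrable lborel (f i)"
  shows "has_bochner_integral (lborel::(real^'n) measure) (\<lambda>x. \<Prod>i\<in>UNIV. f i (x $ i)) (\<Prod>i\<in>UNIV. LINT x|lborel. f i x)"
proof -
  have [measurable]: "f i \<in> borel_measurable borel" for i
    using borel_measurable_integrable[OF f[of i]] by simp
  interpret product_sigma_finite "\<lambda>_::real^'n. lborel::real measure" by standard
  have inj: "(THE j. axis i (1::real) = axis j 1) = i" for i :: 'n
    by (rule the_equality) (auto simp: axis_eq_axis)
  let ?g = "\<lambda>b. f (THE j. b = axis j 1)"
  let ?s = "\<lambda>x. \<Sum>b\<in>Basis. x b *\<^sub>R b :: real^'n"
  have [measurable]: "?s \<in> measurable (Pi\<^sub>M Basis (\<lambda>_. lborel)) borel"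
    by measurable
  have co: "?s x $ i = x (axis i 1)" for x i
  proof -
    have "?s x $ i = ?s x \<bullet> axis i 1" by (simp add: inner_axis)
    also have "\<dots> = x (axis i 1)" by (rule inner_sum_left_Basis) (auto simp: Basis_vec_def)
    finally show ?thesis .
  qed
  have lb: "(lborel::(real^'n) measure) = distr (Pi\<^sub>M Basis (\<lambda>_. lborel)) borel ?s"
    by (rule lborel_eq)
  have "has_bochner_integral (Pi\<^sub>M Basis (\<lambda>_. lborel)) (\<lambda>x. \<Prod>b\<in>(Basis::(real^'n) set). ?g b (x b))
    (\<Prod>b\<in>(Basis::(real^'n) set). LINT x|lborel. ?g b x)"
    unfolding has_bochner_integral_iff using product_integrable_prod[of "Basis::(real^'n) set" ?g] f
      product_integral_prod[of "Basis::(real^'n) set" ?g] by auto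
  then have "has_bochner_integral (Pi\<^sub>M Basis (\<lambda>_. lborel)) (\<lambda>x. \<Prod>i\<in>UNIV. f i (?s x $ i))
    (\<Prod>i\<in>UNIV. LINT x|lborel. f i x)"
    unfolding prod_Basis_vec inj co .
  then show ?thesis
    unfolding has_bochner_integral_iff lb by (simp add: integrable_distr_eq integral_distr)
qed

lemma emeasure_vec_box:
  fixes S :: "'n::finite \<Rightarrow> real set"
  assumes [measurable]: "\<And>i. S i \<in> sets borel"
  shows "emeasure lborel {x::real^'n. \<forall>i. x $ i \<in> S i} = (\<Prod>i\<in>UNIV. emeasure lborel (S i))"
proof -
  have [measurable]: "{x::real^'n. \<forall>i. x $ i \<in> S i} \<in> sets borel"
    by measurable
  have "emeasure lborel {x::real^'n. \<forall>i. x $ i \<in> S i} = (\<integral>\<^sup>+x. indicator {x::real^'n. \<forall>i. x $ i \<in> S i} x \<partial>lborel)"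
    by simp
  also have "\<dots> = (\<integral>\<^sup>+x. (\<Prod>i\<in>UNIV. indicator (S i) (x $ i)) \<partial>(lborel :: (real^'n) measure))"
  proof (intro nn_integral_cong)
    fix x :: "real^'n"
    show "indicator {x::real^'n. \<forall>i. x $ i \<in> S i} x = (\<Prod>i\<in>UNIV. indicator (S i) (x $ i) :: ennreal)"
      by (cases "\<forall>i. x $ i \<in> S i") (auto simp: indicator_def intro!: prod_zero[symmetric])
  qed
  also have "\<dots> = (\<Prod>i\<in>UNIV. emeasure lborel (S i))"
    by (subst nn_integral_vec_prod) auto
  finally show ?thesis .
qed

lemma power2_norm_vec: "(norm x)\<^sup>2 = (\<Sum>i\<in>UNIV. (x $ i)\<^sup>2)" for x :: "real^'n"
  by (simp add: norm_vec_def L2_set_def sum_nonneg)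

lemma iexp_sum:
  "finite I \<Longrightarrow> exp (\<i> * complex_of_real (\<Sum>i\<in>I. g i)) = (\<Prod>i\<in>I. exp (\<i> * complex_of_real (g i)))"
  by (simp add: of_real_sum sum_distrib_left exp_sum)

section \<open>Schwartz functions with a Gaussian factor\<close>

text \<open>The algebra generated by coordinates and plane waves. Differentiating such a function
  times a Gaussian gives another one times the same Gaussian, so all iterated derivatives have one
  shape, and polynomial growth of the first factor is enough for rapid decay.\<close>

inductive_set exp_poly :: "(real^'n::finite \<Rightarrow> complex) set" where
  const: "(\<lambda>x. c) \<in> exp_poly"
| coord: "(\<lambda>x. complex_of_real (x $ i)) \<in> exp_poly"
| cexp: "(\<lambda>x. exp (\<i> * complex_of_real (c * x $ i))) \<in> exp_poly"
| add: "p \<in> exp_poly \<Longrightarrow> q \<in> exp_poly \<Longrightarrow> (\<lambda>x. p x + q x) \<in> exp_poly"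
| mult: "p \<in> exp_poly \<Longrightarrow> q \<in> exp_poly \<Longrightarrow> (\<lambda>x. p x * q x) \<in> exp_poly"

lemma exp_poly_sum: "finite I \<Longrightarrow> (\<And>i. i \<in> I \<Longrightarrow> p i \<in> exp_poly) \<Longrightarrow> (\<lambda>x. \<Sum>i\<in>I. p i x) \<in> exp_poly"
  by (induction I rule: finite_induct) (auto intro: exp_poly.intros)

lemma exp_poly_prod: "finite I \<Longrightarrow> (\<And>i. i \<in> I \<Longrightarrow> p i \<in> exp_poly) \<Longrightarrow> (\<lambda>x. \<Prod>i\<in>I. p i x) \<in> exp_poly"
  by (induction I rule: finite_induct) (auto intro: exp_poly.intros)

lemma has_derivative_coord:
  "((\<lambda>x::real^'n::finite. complex_of_real (x $ i)) has_derivative (\<lambda>v. complex_of_real (v $ i))) (at x)"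
  by (intro bounded_linear_imp_has_derivative bounded_linear_compose[OF bounded_linear_of_real]
      bounded_linear_vec_nth)

lemma has_derivative_cexp:
  fixes g :: "'a::real_normed_vector \<Rightarrow> complex"
  assumes "(g has_derivative g') (at x)"
  shows "((\<lambda>x. exp (g x)) has_derivative (\<lambda>v. g' v * exp (g x))) (at x)"
  using has_derivative_compose[OF assms DERIV_exp[unfolded has_field_derivative_def]]
  by (simp add: mult.commute)

lemma exp_poly_has_derivative:
  fixes p :: "real^'n::finite \<Rightarrow> complex"
  assumes "p \<in> exp_poly"
  shows "\<exists>p'. (\<forall>x. (p has_derivative (\<lambda>v. p' v x)) (at x)) \<and> (\<forall>v. p' v \<in> exp_poly)"
  using assms
proof induction
  case (const c)
  show ?case by (intro exI[of _ "\<lambda>v x. 0"]) (auto intro: exp_poly.intros)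
next
  case (coord i)
  show ?case
    by (intro exI[of _ "\<lambda>v x. complex_of_real (v $ i)"]) (auto intro: exp_poly.intros has_derivative_coord)
next
  case (cexp c i)
  have "((\<lambda>x. exp (\<i> * complex_of_real (c * x $ i))) has_derivative
      (\<lambda>v. \<i> * complex_of_real (c * v $ i) * exp (\<i> * complex_of_real (c * x $ i)))) (at x)" for x :: "real^'n"
    unfolding of_real_mult
    by (intro has_derivative_cexp has_derivative_mult_right has_derivative_coord)
  then show ?case
    by (intro exI[of _ "\<lambda>v x. \<i> * complex_of_real (c * v $ i) * exp (\<i> * complex_of_real (c * x $ i))"])
      (auto intro!: exp_poly.intros simp del: of_real_mult)
next
  case (add p q)
  then obtain p' q' where
    "(\<forall>x. (p has_derivative (\<lambda>v. p' v x)) (at x)) \<and> (\<forall>v. p' v \<in> exp_poly)"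
    "(\<forall>x. (q has_derivative (\<lambda>v. q' v x)) (at x)) \<and> (\<forall>v. q' v \<in> exp_poly)" by blast
  then show ?case
    by (intro exI[of _ "\<lambda>v x. p' v x + q' v x"]) (auto intro!: exp_poly.intros has_derivative_add)
next
  case (mult p q)
  then obtain p' q' where
    "(\<forall>x. (p has_derivative (\<lambda>v. p' v x)) (at x)) \<and> (\<forall>v. p' v \<in> exp_poly)"
    "(\<forall>x. (q has_derivative (\<lambda>v. q' v x)) (at x)) \<and> (\<forall>v. q' v \<in> exp_poly)" by blast
  with mult.hyps show ?case
    by (intro exI[of _ "\<lambda>v x. p x * q' v x + p' v x * q x"]) (auto intro!: exp_poly.intros has_derivative_mult)
qed

lemma exp_poly_bound:
  fixes p :: "real^'n::finite \<Rightarrow> complex"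
  assumes "p \<in> exp_poly"
  shows "\<exists>C m. \<forall>x. norm (p x) \<le> C * (1 + norm x) ^ m"
  using assms
proof induction
  case (const c)
  show ?case by (intro exI[of _ "norm c"] exI[of _ 0]) auto
next
  case (coord i)
  have "\<bar>x $ i\<bar> \<le> 1 + norm x" for x :: "real^'n"
    using component_le_norm_cart[of x i] by linarith
  then show ?case by (intro exI[of _ 1] exI[of _ 1]) auto
next
  case (cexp c i)
  show ?case by (intro exI[of _ 1] exI[of _ 0]) auto
next
  case (add p q)
  then obtain C m D l where *: "norm (p x) \<le> C * (1 + norm x) ^ m" "norm (q x) \<le> D * (1 + norm x) ^ l" for x
    by blast
  have "norm (p x + q x) \<le> (\<bar>C\<bar> + \<bar>D\<bar>) * (1 + norm x) ^ (m + l)" for x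
  proof -
    have "norm (p x) \<le> \<bar>C\<bar> * (1 + norm x) ^ (m + l)"
      by (rule order_trans[OF *(1)]) (intro mult_mono power_increasing, auto)
    moreover have "norm (q x) \<le> \<bar>D\<bar> * (1 + norm x) ^ (m + l)"
      by (rule order_trans[OF *(2)]) (intro mult_mono power_increasing, auto)
    ultimately show ?thesis
      using norm_triangle_ineq[of "p x" "q x"] by (simp add: algebra_simps)
  qed
  then show ?case by blast
next
  case (mult p q)
  then obtain C m D l where *: "norm (p x) \<le> C * (1 + norm x) ^ m" "norm (q x) \<le> D * (1 + norm x) ^ l" for x
    by blast
  have "norm (p x * q x) \<le> (C * D) * (1 + norm x) ^ (m + l)" for x
    using mult_mono[OF *(1)[of x] *(2)[of x]] order_trans[OF norm_ge_zero *(1)[of x]]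
    by (simp add: norm_mult power_add algebra_simps)
  then show ?case by blast
qed

definition gauss :: "('n::finite \<Rightarrow> real) \<Rightarrow> real^'n \<Rightarrow> complex" where
  "gauss \<sigma> x = exp (complex_of_real (- (\<Sum>i\<in>UNIV. (\<sigma> i)\<^sup>2 * (x $ i)\<^sup>2) / 2))"

lemma gauss_has_derivative:
  "(gauss \<sigma> has_derivative (\<lambda>v. (\<Sum>i\<in>UNIV. complex_of_real (- (\<sigma> i)\<^sup>2 * v $ i) * complex_of_real (x $ i)) * gauss \<sigma> x)) (at x)"
proof -
  have *: "gauss \<sigma> = (\<lambda>x. exp (\<Sum>i\<in>UNIV. complex_of_real (- (\<sigma> i)\<^sup>2 / 2) * (complex_of_real (x $ i) * complex_of_real (x $ i))))"
    unfolding gauss_def[abs_def]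
    by (simp add: sum_divide_distrib sum_negf[symmetric] power2_eq_square algebra_simps)
  have **: "((\<lambda>x. \<Sum>i\<in>UNIV. complex_of_real (- (\<sigma> i)\<^sup>2 / 2) * (complex_of_real (x $ i) * complex_of_real (x $ i))) has_derivative
     (\<lambda>v. \<Sum>i\<in>UNIV. complex_of_real (- (\<sigma> i)\<^sup>2 / 2) * (complex_of_real (x $ i) * complex_of_real (v $ i) + complex_of_real (v $ i) * complex_of_real (x $ i)))) (at x)"
    by (intro has_derivative_sum has_derivative_mult_right has_derivative_mult has_derivative_coord)
  show ?thesis
    unfolding *
    by (rule has_derivative_eq_rhs[OF has_derivative_cexp[OF **]])
      (auto simp: sum_distrib_left sum_distrib_right fun_eq_iff algebra_simps intro!: sum.cong)
qed

text \<open>By \<open>1 + r <= exp r\<close> the exponent is at most \<open>m * r - c * r^2\<close>,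
  and completing the square bounds it by \<open>m^2 / (4 * c)\<close>.\<close>

lemma power_times_exp_neg_sq_bounded:
  assumes "c > 0"
  shows "\<exists>C. \<forall>r\<ge>0. (1 + r) ^ m * exp (- c * r\<^sup>2) \<le> (C::real)"
proof -
  have "(1 + r) ^ m * exp (- c * r\<^sup>2) \<le> exp ((real m)\<^sup>2 / (4 * c))" if "r \<ge> 0" for r :: real
  proof -
    have "(1 + r) ^ m \<le> exp r ^ m"
      using that by (intro power_mono) auto
    then have "(1 + r) ^ m * exp (- c * r\<^sup>2) \<le> exp r ^ m * exp (- c * r\<^sup>2)"
      by (intro mult_right_mono) auto
    also have "\<dots> = exp (real m * r - c * r\<^sup>2)"
      by (simp add: exp_of_nat_mult[symmetric] exp_add[symmetric])
    also have "real m * r - c * r\<^sup>2 \<le> (real m)\<^sup>2 / (4 * c)"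
      using zero_le_power2[of "real m - 2 * c * r"] assms
      by (simp add: field_simps power2_eq_square)
    finally show ?thesis by simp
  qed
  then show ?thesis by blast
qed

lemma exp_poly_gauss_dir_deriv:
  assumes "p \<in> exp_poly"
  shows "(\<lambda>x. p x * gauss \<sigma> x) differentiable at x"
    and "\<exists>p'\<in>exp_poly. dir_deriv v (\<lambda>x. p x * gauss \<sigma> x) = (\<lambda>x. p' x * gauss \<sigma> x)"
proof -
  obtain p' where p': "\<And>x. (p has_derivative (\<lambda>v. p' v x)) (at x)" "\<And>v. p' v \<in> exp_poly"
    using exp_poly_has_derivative[OF assms] by blast
  let ?l = "\<lambda>v x. \<Sum>i\<in>UNIV. complex_of_real (- (\<sigma> i)\<^sup>2 * v $ i) * complex_of_real (x $ i)"
  have der: "((\<lambda>x. p x * gauss \<sigma> x) has_derivative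
      (\<lambda>v. (p' v x + p x * ?l v x) * gauss \<sigma> x)) (at x)" for x
    by (rule has_derivative_eq_rhs[OF has_derivative_mult[OF p'(1) gauss_has_derivative]])
      (auto simp: algebra_simps)
  show "(\<lambda>x. p x * gauss \<sigma> x) differentiable at x"
    using der unfolding differentiable_def by blast
  have "dir_deriv v (\<lambda>x. p x * gauss \<sigma> x) = (\<lambda>x. (p' v x + p x * ?l v x) * gauss \<sigma> x)"
    unfolding dir_deriv_def frechet_derivative_at[OF der, symmetric] by simp
  moreover have "(\<lambda>x. p' v x + p x * ?l v x) \<in> exp_poly"
    by (intro exp_poly.add exp_poly.mult exp_poly_sum exp_poly.const exp_poly.coord p' assms) auto
  ultimately show "\<exists>p'\<in>exp_poly. dir_deriv v (\<lambda>x. p x * gauss \<sigma> x) = (\<lambda>x. p' x * gauss \<sigma> x)"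
    by (intro bexI[of _ "\<lambda>x. p' v x + p x * ?l v x"])
qed

lemma norm_gauss_le:
  assumes "\<And>i. \<sigma> i \<ge> 1"
  shows "norm (gauss \<sigma> x) \<le> exp (- (1/2) * (norm x)\<^sup>2)"
proof -
  have "(norm x)\<^sup>2 = (\<Sum>i\<in>UNIV. (x $ i)\<^sup>2)"
    by (rule power2_norm_vec)
  also have "\<dots> \<le> (\<Sum>i\<in>UNIV. (\<sigma> i)\<^sup>2 * (x $ i)\<^sup>2)"
    using assms by (intro sum_mono) (simp add: mult_le_cancel_right1 one_le_power)
  finally show ?thesis
    unfolding gauss_def norm_exp_eq_Re by simp
qed

lemma exp_poly_gauss_schwartz:
  assumes "p \<in> exp_poly" and \<sigma>: "\<And>i. \<sigma> i \<ge> 1"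
  shows "(\<lambda>x. p x * gauss \<sigma> x) \<in> schwartz"
proof -
  have iter: "\<exists>p'\<in>exp_poly. iter_dir_deriv vs (\<lambda>x. p x * gauss \<sigma> x) = (\<lambda>x. p' x * gauss \<sigma> x)" for vs
    by (induction vs) (use assms(1) exp_poly_gauss_dir_deriv(2) in fastforce)+
  have "iter_dir_deriv vs (\<lambda>x. p x * gauss \<sigma> x) differentiable at x" for vs x
    using iter[of vs] exp_poly_gauss_dir_deriv(1) by metis
  moreover have "\<exists>C. \<forall>x. (1 + norm x) ^ N * norm (iter_dir_deriv vs (\<lambda>x. p x * gauss \<sigma> x) x) \<le> C" for vs N
  proof -
    obtain p' where p': "p' \<in> exp_poly" "iter_dir_deriv vs (\<lambda>x. p x * gauss \<sigma> x) = (\<lambda>x. p' x * gauss \<sigma> x)"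
      using iter by blast
    obtain C m where C: "\<And>x. norm (p' x) \<le> C * (1 + norm x) ^ m"
      using exp_poly_bound[OF p'(1)] by blast
    obtain B where B: "\<And>r::real. r \<ge> 0 \<Longrightarrow> (1 + r) ^ (N + m) * exp (- (1/2) * r\<^sup>2) \<le> B"
      using power_times_exp_neg_sq_bounded[of "1/2" "N + m"] by (auto simp del: minus_mult_left[symmetric])
    have "(1 + norm x) ^ N * norm (p' x * gauss \<sigma> x) \<le> \<bar>C\<bar> * B" for x
    proof -
      have "norm (p' x) \<le> \<bar>C\<bar> * (1 + norm x) ^ m"
        by (rule order_trans[OF C]) (intro mult_right_mono, auto)
      then have "norm (p' x * gauss \<sigma> x) \<le> (\<bar>C\<bar> * (1 + norm x) ^ m) * exp (- (1/2) * (norm x)\<^sup>2)"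
        unfolding norm_mult by (intro mult_mono norm_gauss_le \<sigma>) auto
      then have "(1 + norm x) ^ N * norm (p' x * gauss \<sigma> x)
          \<le> (1 + norm x) ^ N * ((\<bar>C\<bar> * (1 + norm x) ^ m) * exp (- (1/2) * (norm x)\<^sup>2))"
        by (intro mult_left_mono) auto
      also have "\<dots> = \<bar>C\<bar> * ((1 + norm x) ^ (N + m) * exp (- (1/2) * (norm x)\<^sup>2))"
        by (simp add: power_add algebra_simps)
      also have "\<dots> \<le> \<bar>C\<bar> * B"
        by (intro mult_left_mono B) auto
      finally show ?thesis .
    qed
    then show ?thesis unfolding p'(2) by blast
  qed
  ultimately show ?thesis
    unfolding schwartz_def by blast
qed

section \<open>Gaussian wave packets\<close>

text \<open>Here \<open>\<sigma>\<close> is the standard deviation on the frequency side: in space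
  the envelope has width \<open>1 / \<sigma>\<close>. With height 1 the transform is
  \<open>2 * pi\<close> times a plain sum of normal densities centred at \<open>V\<close>.\<close>

definition packet :: "real \<Rightarrow> real set \<Rightarrow> real \<Rightarrow> complex" where
  "packet \<sigma> V x = exp (complex_of_real (- \<sigma>\<^sup>2 * x\<^sup>2 / 2)) * (\<Sum>v\<in>V. exp (\<i> * complex_of_real (v * x)))"

text \<open>The evolution of a unit Gaussian at position \<open>z\<close> and time \<open>s\<close>.
  All later estimates come from its value at the origin and its Lipschitz continuity.\<close>

definition gauss_osc :: "real \<Rightarrow> real \<Rightarrow> complex" where
  "gauss_osc z s = (LINT \<eta>|lborel. complex_of_real (std_normal_density \<eta>) * exp (\<i> * complex_of_real (\<eta> * z + \<eta>\<^sup>2 * s)))"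

lemma integrable_normal_osc:
  fixes g :: "real \<Rightarrow> real"
  assumes "\<sigma> > 0" and [measurable]: "g \<in> borel_measurable borel"
  shows "integrable lborel (\<lambda>\<xi>. complex_of_real (normal_density \<mu> \<sigma> \<xi>) * exp (\<i> * complex_of_real (g \<xi>)))"
  by (rule Bochner_Integration.integrable_bound[OF integrable_normal_density[OF assms(1), of \<mu>]]) 
    (auto simp: norm_mult)

lemma fourier_std_normal:
  "(LINT x|lborel. complex_of_real (std_normal_density x) * exp (\<i> * complex_of_real (x * t))) = complex_of_real (exp (- t\<^sup>2 / 2))"
proof -
  have "char std_normal_distribution t = (LINT x|lborel. std_normal_density x *\<^sub>R iexp (t * x))"
    unfolding char_def by (rule integral_density) auto
  then show ?thesis
    by (simp add: char_std_normal_distribution scaleR_conv_of_real mult.commute)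
qed

lemma integral_normal_affine:
  fixes h :: "real \<Rightarrow> complex"
  assumes "\<sigma> > 0"
  shows "(LINT \<xi>|lborel. complex_of_real (normal_density v \<sigma> \<xi>) * h \<xi>) =
    (LINT \<eta>|lborel. complex_of_real (std_normal_density \<eta>) * h (v + \<sigma> * \<eta>))"
proof -
  have "\<sigma> * normal_density v \<sigma> (v + \<sigma> * x) = std_normal_density x" for x
    using assms by (simp add: normal_density_def real_sqrt_mult power_mult_distrib)
  then have *: "complex_of_real \<sigma> * complex_of_real (normal_density v \<sigma> (v + \<sigma> * x)) = complex_of_real (std_normal_density x)" for x
    by (metis of_real_mult)
  show ?thesis
    using assms
    by (subst lborel_integral_real_affine[where c=\<sigma> and t=v])
      (auto simp: scaleR_conv_of_real simp flip: integral_mult_right_zero * mult.assoc)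
qed

text \<open>Up to the factor \<open>sqrt (2 * pi) / \<sigma>\<close> the envelope is a normal
  density of standard deviation \<open>1 / \<sigma>\<close>, so each term is the characteristic
  function of the standard normal distribution at \<open>(v - \<xi>) / \<sigma>\<close>.\<close>

lemma fourier_packet:
  assumes "\<sigma> > 0" "finite V"
  shows "integrable lborel (\<lambda>x. packet \<sigma> V x * exp (- \<i> * complex_of_real (x * \<xi>)))"
    and "(LINT x|lborel. packet \<sigma> V x * exp (- \<i> * complex_of_real (x * \<xi>))) =
      complex_of_real (2 * pi * (\<Sum>v\<in>V. normal_density v \<sigma> \<xi>))"
proof -
  let ?g = "\<lambda>v x. complex_of_real (sqrt (2 * pi) / \<sigma>) *
    (complex_of_real (normal_density 0 (1/\<sigma>) x) * exp (\<i> * complex_of_real (x * (v - \<xi>))))"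
  have eq: "packet \<sigma> V x * exp (- \<i> * complex_of_real (x * \<xi>)) = (\<Sum>v\<in>V. ?g v x)" for x
  proof -
    have 1: "exp (- \<sigma>\<^sup>2 * x\<^sup>2 / 2) = sqrt (2 * pi) / \<sigma> * normal_density 0 (1/\<sigma>) x"
      using assms by (simp add: normal_density_def real_sqrt_divide real_sqrt_mult field_simps power_divide)
    have 2: "exp (\<i> * complex_of_real (v * x)) * exp (- \<i> * complex_of_real (x * \<xi>)) = exp (\<i> * complex_of_real (x * (v - \<xi>)))" for v
      by (simp add: exp_add[symmetric] algebra_simps)
    show ?thesis
      unfolding packet_def exp_of_real 1 of_real_mult sum_distrib_left sum_distrib_right mult.assoc 2 
      using 2 by (auto intro!: sum.cong)
  qed
  have int: "integrable lborel (?g v)" for v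
    using assms by (intro integrable_mult_right integrable_normal_osc) auto
  show "integrable lborel (\<lambda>x. packet \<sigma> V x * exp (- \<i> * complex_of_real (x * \<xi>)))"
    unfolding eq by (intro Bochner_Integration.integrable_sum int)
  have "(LINT x|lborel. ?g v x) = complex_of_real (2 * pi * normal_density v \<sigma> \<xi>)" for v
  proof -
    have "(LINT x|lborel. ?g v x) = complex_of_real (sqrt (2 * pi) / \<sigma>) *
        (LINT x|lborel. complex_of_real (std_normal_density x) * exp (\<i> * complex_of_real (x * ((v - \<xi>) / \<sigma>))))"
      using assms by (subst integral_mult_right_zero, subst integral_normal_affine) (auto simp: field_simps)
    also have "\<dots> = complex_of_real (sqrt (2 * pi) / \<sigma> * exp (- ((v - \<xi>) / \<sigma>)\<^sup>2 / 2))"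
      unfolding fourier_std_normal by simp
    also have "sqrt (2 * pi) / \<sigma> * exp (- ((v - \<xi>) / \<sigma>)\<^sup>2 / 2) = 2 * pi * normal_density v \<sigma> \<xi>"
      using assms by (simp add: normal_density_def real_sqrt_mult power_divide power2_commute[of v] field_simps)
    finally show ?thesis .
  qed
  then show "(LINT x|lborel. packet \<sigma> V x * exp (- \<i> * complex_of_real (x * \<xi>))) =
      complex_of_real (2 * pi * (\<Sum>v\<in>V. normal_density v \<sigma> \<xi>))"
    unfolding eq by (subst Bochner_Integration.integral_sum[OF int]) (simp add: sum_distrib_left)
qed

text \<open>Galilean invariance: after \<open>\<xi> = v + \<sigma> * \<eta>\<close> the square in
  the phase splits into the plane wave of frequency \<open>v\<close>, a translation by
  \<open>2 * v * t\<close>, and the evolution of a standard Gaussian for the rescaled time.\<close>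

lemma evolve_normal:
  assumes "\<sigma> > 0"
  shows "(LINT \<xi>|lborel. complex_of_real (normal_density v \<sigma> \<xi>) * exp (\<i> * complex_of_real (\<xi> * x + \<xi>\<^sup>2 * t))) =
    exp (\<i> * complex_of_real (v * x + v\<^sup>2 * t)) * gauss_osc (\<sigma> * (x + 2 * v * t)) (\<sigma>\<^sup>2 * t)"
proof -
  have "exp (\<i> * complex_of_real ((v + \<sigma> * \<eta>) * x + (v + \<sigma> * \<eta>)\<^sup>2 * t)) =
    exp (\<i> * complex_of_real (v * x + v\<^sup>2 * t)) * exp (\<i> * complex_of_real (\<eta> * (\<sigma> * (x + 2 * v * t)) + \<eta>\<^sup>2 * (\<sigma>\<^sup>2 * t)))" for \<eta>
    unfolding exp_add[symmetric] distrib_left[symmetric] of_real_add[symmetric]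
    by (simp add: power2_eq_square algebra_simps)
  then show ?thesis
    unfolding gauss_osc_def integral_normal_affine[OF assms]
    by (subst integral_mult_right_zero[symmetric]) (simp only: mult.left_commute)
qed

lemma integrable_evolve_packet:
  assumes "\<sigma> > 0" "finite V"
  shows "integrable lborel (\<lambda>\<xi>. complex_of_real (2 * pi * (\<Sum>v\<in>V. normal_density v \<sigma> \<xi>)) * exp (\<i> * complex_of_real (\<xi> * x + \<xi>\<^sup>2 * t)))"
  unfolding of_real_mult of_real_sum sum_distrib_left sum_distrib_right mult.assoc
  using assms by (intro Bochner_Integration.integrable_sum integrable_mult_right integrable_normal_osc) auto

lemma evolve_packet:
  assumes "\<sigma> > 0" "finite V"
  shows "(LINT \<xi>|lborel. complex_of_real (2 * pi * (\<Sum>v\<in>V. normal_density v \<sigma> \<xi>)) * exp (\<i> * complex_of_real (\<xi> * x + \<xi>\<^sup>2 * t))) =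
     2 * pi * (\<Sum>v\<in>V. exp (\<i> * complex_of_real (v * x + v\<^sup>2 * t)) * gauss_osc (\<sigma> * (x + 2 * v * t)) (\<sigma>\<^sup>2 * t))"
proof -
  have int: "integrable lborel (\<lambda>\<xi>. complex_of_real (2 * pi) *
     (complex_of_real (normal_density v \<sigma> \<xi>) * exp (\<i> * complex_of_real (\<xi> * x + \<xi>\<^sup>2 * t))))" for v
    using assms by (intro integrable_mult_right integrable_normal_osc) auto
  have "(LINT \<xi>|lborel. complex_of_real (2 * pi * (\<Sum>v\<in>V. normal_density v \<sigma> \<xi>)) * exp (\<i> * complex_of_real (\<xi> * x + \<xi>\<^sup>2 * t)))
    = (LINT \<xi>|lborel. (\<Sum>v\<in>V. complex_of_real (2 * pi) *
     (complex_of_real (normal_density v \<sigma> \<xi>) * exp (\<i> * complex_of_real (\<xi> * x + \<xi>\<^sup>2 * t)))))"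
    by (simp add: sum_distrib_left sum_distrib_right mult.assoc)
  also have "\<dots> = (\<Sum>v\<in>V. complex_of_real (2 * pi) *
     (exp (\<i> * complex_of_real (v * x + v\<^sup>2 * t)) * gauss_osc (\<sigma> * (x + 2 * v * t)) (\<sigma>\<^sup>2 * t)))"
    by (subst Bochner_Integration.integral_sum[OF int])
      (simp only: integral_mult_right_zero evolve_normal[OF assms(1)])
  finally show ?thesis
    by (simp add: sum_distrib_left)
qed

lemma gauss_osc_0: "gauss_osc 0 0 = 1"
  unfolding gauss_osc_def using fourier_std_normal[of 0] by simp

lemma norm_iexp_diff_le: "norm (exp (\<i> * complex_of_real u) - exp (\<i> * complex_of_real v)) \<le> \<bar>u - v\<bar>"
proof -
  have "exp (\<i> * complex_of_real u) - exp (\<i> * complex_of_real v) =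
    exp (\<i> * complex_of_real v) * (exp (\<i> * complex_of_real (u - v)) - 1)"
    by (simp add: right_diff_distrib exp_add[symmetric])
  then show ?thesis
    using iexp_approx1[of "u - v" 0] by (simp add: norm_mult)
qed

text \<open>The two phases differ by at most
  \<open>|\<eta>| * |z - z'| + \<eta>^2 * |s - s'|\<close>. Replacing \<open>|\<eta>|\<close> by
  \<open>(1 + \<eta>^2) / 2\<close> leaves only the mass and the second moment of the standard
  normal density, both equal to 1.\<close>

lemma gauss_osc_diff:
  "norm (gauss_osc z s - gauss_osc z' s') \<le> \<bar>z - z'\<bar> + \<bar>s - s'\<bar>"
proof -
  have int: "integrable lborel (\<lambda>\<eta>. complex_of_real (std_normal_density \<eta>) * exp (\<i> * complex_of_real (\<eta> * z + \<eta>\<^sup>2 * s)))" for z s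
    by (intro integrable_normal_osc) auto
  have 0: "has_bochner_integral lborel std_normal_density 1"
    using std_normal_moment_even[of 0] by simp
  have 2: "has_bochner_integral lborel (\<lambda>x. std_normal_density x * x\<^sup>2) 1"
    using std_normal_moment_even[of 1] by (simp add: fact_numeral)
  have 3: "has_bochner_integral lborel (\<lambda>x. std_normal_density x * ((1 + x\<^sup>2) / 2 * \<bar>z - z'\<bar> + x\<^sup>2 * \<bar>s - s'\<bar>)) 
     ((1 + 1) / 2 * \<bar>z - z'\<bar> + 1 * \<bar>s - s'\<bar>)"
    using has_bochner_integral_add[OF has_bochner_integral_mult_left[OF has_bochner_integral_add[OF 0 2], of "\<bar>z - z'\<bar> / 2"] has_bochner_integral_mult_left[OF 2, of "\<bar>s - s'\<bar>"]]
    by (simp add: algebra_simps add_divide_distrib)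
  have eq: "gauss_osc z s - gauss_osc z' s' = (LINT \<eta>|lborel. complex_of_real (std_normal_density \<eta>) *
     (exp (\<i> * complex_of_real (\<eta> * z + \<eta>\<^sup>2 * s)) - exp (\<i> * complex_of_real (\<eta> * z' + \<eta>\<^sup>2 * s'))))"
    unfolding gauss_osc_def right_diff_distrib by (intro Bochner_Integration.integral_diff[symmetric] int)
  have "norm (gauss_osc z s - gauss_osc z' s') \<le> (LINT \<eta>|lborel. std_normal_density \<eta> * ((1 + \<eta>\<^sup>2) / 2 * \<bar>z - z'\<bar> + \<eta>\<^sup>2 * \<bar>s - s'\<bar>))"
    unfolding eq
  proof (rule Bochner_Integration.integral_norm_bound_integral)
    show "integrable lborel (\<lambda>\<eta>. std_normal_density \<eta> * ((1 + \<eta>\<^sup>2) / 2 * \<bar>z - z'\<bar> + \<eta>\<^sup>2 * \<bar>s - s'\<bar>))"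
      using 3 by (rule integrable.intros)
    show "integrable lborel (\<lambda>\<eta>. complex_of_real (std_normal_density \<eta>) *
     (exp (\<i> * complex_of_real (\<eta> * z + \<eta>\<^sup>2 * s)) - exp (\<i> * complex_of_real (\<eta> * z' + \<eta>\<^sup>2 * s'))))"
      unfolding right_diff_distrib by (intro Bochner_Integration.integrable_diff int)
    fix \<eta> :: real
    have "\<bar>\<eta>\<bar> \<le> (1 + \<eta>\<^sup>2) / 2"
      using zero_le_power2[of "\<bar>\<eta>\<bar> - 1"] by (simp add: power2_diff)
    then have "\<bar>\<eta>\<bar> * \<bar>z - z'\<bar> \<le> (1 + \<eta>\<^sup>2) / 2 * \<bar>z - z'\<bar>"
      by (rule mult_right_mono) auto
    moreover have "(\<eta> * z + \<eta>\<^sup>2 * s) - (\<eta> * z' + \<eta>\<^sup>2 * s') = \<eta> * (z - z') + \<eta>\<^sup>2 * (s - s')"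
      by (simp add: algebra_simps)
    then have "\<bar>(\<eta> * z + \<eta>\<^sup>2 * s) - (\<eta> * z' + \<eta>\<^sup>2 * s')\<bar> \<le> \<bar>\<eta>\<bar> * \<bar>z - z'\<bar> + \<eta>\<^sup>2 * \<bar>s - s'\<bar>"
      using abs_triangle_ineq[of "\<eta> * (z - z')" "\<eta>\<^sup>2 * (s - s')"] by (simp add: abs_mult)
    ultimately have "norm (exp (\<i> * complex_of_real (\<eta> * z + \<eta>\<^sup>2 * s)) - exp (\<i> * complex_of_real (\<eta> * z' + \<eta>\<^sup>2 * s')))
       \<le> (1 + \<eta>\<^sup>2) / 2 * \<bar>z - z'\<bar> + \<eta>\<^sup>2 * \<bar>s - s'\<bar>"
      using norm_iexp_diff_le[of "\<eta> * z + \<eta>\<^sup>2 * s" "\<eta> * z' + \<eta>\<^sup>2 * s'"] by linarith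
    then show "norm (complex_of_real (std_normal_density \<eta>) *
     (exp (\<i> * complex_of_real (\<eta> * z + \<eta>\<^sup>2 * s)) - exp (\<i> * complex_of_real (\<eta> * z' + \<eta>\<^sup>2 * s'))))
      \<le> std_normal_density \<eta> * ((1 + \<eta>\<^sup>2) / 2 * \<bar>z - z'\<bar> + \<eta>\<^sup>2 * \<bar>s - s'\<bar>)"
      unfolding norm_mult by (simp add: mult_left_mono)
  qed
  also have "\<dots> = \<bar>z - z'\<bar> + \<bar>s - s'\<bar>"
    by (rule has_bochner_integral_integral_eq[OF 3, THEN trans]) simp
  finally show ?thesis .
qed

definition wave :: "('n::finite \<Rightarrow> real) \<Rightarrow> ('n \<Rightarrow> real set) \<Rightarrow> real^'n \<Rightarrow> complex" where
  "wave \<sigma> V x = (\<Prod>i\<in>UNIV. packet (\<sigma> i) (V i) (x $ i))"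

lemma wave_schwartz:
  assumes "\<And>i. \<sigma> i \<ge> 1" "\<And>i. finite (V i)"
  shows "wave \<sigma> V \<in> schwartz"
proof -
  have "wave \<sigma> V = (\<lambda>x. (\<Prod>i\<in>UNIV. \<Sum>v\<in>V i. exp (\<i> * complex_of_real (v * x $ i))) * gauss \<sigma> x)"
  proof
    fix x
    have "gauss \<sigma> x = (\<Prod>i\<in>UNIV. exp (complex_of_real (- (\<sigma> i)\<^sup>2 * (x $ i)\<^sup>2 / 2)))"
      unfolding gauss_def by (simp add: exp_sum[symmetric] sum_negf sum_divide_distrib)
    then show "wave \<sigma> V x = (\<Prod>i\<in>UNIV. \<Sum>v\<in>V i. exp (\<i> * complex_of_real (v * x $ i))) * gauss \<sigma> x"
      unfolding wave_def packet_def prod.distrib by (simp only: mult.commute)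
  qed
  moreover have "(\<lambda>x. \<Prod>i\<in>UNIV. \<Sum>v\<in>V i. exp (\<i> * complex_of_real (v * x $ i))) \<in> exp_poly"
    by (intro exp_poly_prod exp_poly_sum exp_poly.cexp assms) auto
  ultimately show ?thesis
    by (simp only: exp_poly_gauss_schwartz[OF _ assms(1)])
qed

lemma fourier_wave:
  assumes "\<And>i. \<sigma> i > 0" "\<And>i. finite (V i)"
  shows "fourier (wave \<sigma> V) \<xi> = (\<Prod>i\<in>UNIV. complex_of_real (2 * pi * (\<Sum>v\<in>V i. normal_density v (\<sigma> i) (\<xi> $ i))))"
proof -
  have "wave \<sigma> V x * exp (- \<i> * complex_of_real (x \<bullet> \<xi>)) =
      (\<Prod>i\<in>UNIV. packet (\<sigma> i) (V i) (x $ i) * exp (- \<i> * complex_of_real (x $ i * \<xi> $ i)))" for x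
    unfolding wave_def prod.distrib inner_vec_def of_real_sum sum_distrib_left
    by (subst exp_sum) (auto simp: inner_real_def)
  then show ?thesis
    unfolding fourier_def
    using has_bochner_integral_integral_eq[OF has_bochner_integral_vec_prod[OF fourier_packet(1)[OF assms]]]
      fourier_packet(2)[OF assms] by simp
qed

lemma schroedinger_wave:
  fixes \<sigma> :: "'n::finite \<Rightarrow> real"
  assumes "\<And>i. \<sigma> i > 0" "\<And>i. finite (V i)"
  shows "schroedinger t (wave \<sigma> V) x = (\<Prod>i\<in>UNIV. \<Sum>v\<in>V i.
    exp (\<i> * complex_of_real (v * x $ i + v\<^sup>2 * t)) * gauss_osc (\<sigma> i * (x $ i + 2 * v * t)) ((\<sigma> i)\<^sup>2 * t))"
proof -
  let ?F = "\<lambda>i \<xi>. complex_of_real (2 * pi * (\<Sum>v\<in>V i. normal_density v (\<sigma> i) \<xi>)) * exp (\<i> * complex_of_real (\<xi> * x $ i + \<xi>\<^sup>2 * t))"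
  have "fourier (wave \<sigma> V) \<xi> * exp (\<i> * complex_of_real (\<xi> \<bullet> x + (norm \<xi>)\<^sup>2 * t)) = (\<Prod>i\<in>UNIV. ?F i (\<xi> $ i))" for \<xi>
  proof -
    have "\<xi> \<bullet> x + (norm \<xi>)\<^sup>2 * t = (\<Sum>i\<in>UNIV. \<xi> $ i * x $ i + (\<xi> $ i)\<^sup>2 * t)"
      by (simp add: power2_norm_vec inner_vec_def sum.distrib sum_distrib_right)
    then show ?thesis
      unfolding fourier_wave[OF assms] prod.distrib by (simp only: iexp_sum[OF finite_class.finite_UNIV])
  qed
  then have "schroedinger t (wave \<sigma> V) x = complex_of_real (1 / (2 * pi) ^ CARD('n)) * (LINT \<xi>|lborel. (\<Prod>i\<in>UNIV. ?F i (\<xi> $ i)))"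
    unfolding schroedinger_def by presburger
  also have "(LINT \<xi>|(lborel :: (real^'n) measure). (\<Prod>i\<in>UNIV. ?F i (\<xi> $ i))) = (\<Prod>i\<in>UNIV. LINT \<xi>|lborel. ?F i \<xi>)"
    by (rule has_bochner_integral_integral_eq[OF has_bochner_integral_vec_prod])
      (rule integrable_evolve_packet[OF assms])
  finally show ?thesis
    unfolding evolve_packet[OF assms] prod.distrib by simp
qed

section \<open>Almost orthogonality of the frequency bumps and the Sobolev norm\<close>

text \<open>The parallelogram identity gives \<open>(u - v)^2 / 2 <= (x - u)^2 + (x - v)^2\<close>.
  Part of the exponent is spent on decay in \<open>u - v\<close>; the rest still is a Gaussian in
  \<open>x\<close>, of twice the variance. Hence cross terms between distant bumps are negligible
  even after integration against weights.\<close>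

lemma normal_density_mult_le:
  assumes "\<sigma> > 0"
  shows "normal_density u \<sigma> x * normal_density v \<sigma> x \<le>
    1 / \<sigma> * (normal_density u (sqrt 2 * \<sigma>) x * exp (- (u - v)\<^sup>2 / (8 * \<sigma>\<^sup>2)))"
proof -
  have "(u - v)\<^sup>2 / 2 \<le> (x - u)\<^sup>2 + (x - v)\<^sup>2"
  proof -
    have "(x - u)\<^sup>2 + (x - v)\<^sup>2 - (u - v)\<^sup>2 / 2 = (2 * x - u - v)\<^sup>2 / 2"
      by (simp add: power2_eq_square field_simps)
    then show ?thesis
      using zero_le_power2[of "2 * x - u - v"] by linarith
  qed
  then have "- (x - u)\<^sup>2 / (2 * \<sigma>\<^sup>2) + - (x - v)\<^sup>2 / (2 * \<sigma>\<^sup>2) \<le> - (x - u)\<^sup>2 / (4 * \<sigma>\<^sup>2) + - (u - v)\<^sup>2 / (8 * \<sigma>\<^sup>2)"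
  proof -
    assume "(u - v)\<^sup>2 / 2 \<le> (x - u)\<^sup>2 + (x - v)\<^sup>2"
    then have "(- (x - u)\<^sup>2 / 2 - (x - v)\<^sup>2 / 2) / \<sigma>\<^sup>2 \<le> (- (x - u)\<^sup>2 / 4 - (u - v)\<^sup>2 / 8) / \<sigma>\<^sup>2"
      using zero_le_power2[of "x - v"] by (intro divide_right_mono) (linarith, simp)
    then show ?thesis by (simp add: diff_divide_distrib)
  qed
  then have e: "exp (- (x - u)\<^sup>2 / (2 * \<sigma>\<^sup>2)) * exp (- (x - v)\<^sup>2 / (2 * \<sigma>\<^sup>2)) \<le>
    exp (- (x - u)\<^sup>2 / (4 * \<sigma>\<^sup>2)) * exp (- (u - v)\<^sup>2 / (8 * \<sigma>\<^sup>2))"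
    unfolding exp_add[symmetric] by simp
  have c: "1 / sqrt (2 * pi * \<sigma>\<^sup>2) * (1 / sqrt (2 * pi * \<sigma>\<^sup>2)) \<le> 1 / \<sigma> * (1 / sqrt (2 * pi * (sqrt 2 * \<sigma>)\<^sup>2))"
  proof -
    have "sqrt (2 * pi * (sqrt 2 * \<sigma>)\<^sup>2) = 2 * sqrt pi * \<sigma>"
      using assms by (simp add: power_mult_distrib real_sqrt_mult)
    moreover have "sqrt pi \<le> pi"
      using pi_ge_two by (intro real_le_lsqrt) (auto simp: power2_eq_square)
    then have "\<sigma> * (2 * sqrt pi * \<sigma>) \<le> 2 * pi * \<sigma>\<^sup>2"
      using assms by (simp add: power2_eq_square)
    ultimately show ?thesis
      using assms by (simp add: frac_le)
  qed
  show ?thesis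
    using mult_mono[OF c e] assms
    by (simp add: normal_density_def power_mult_distrib mult_ac)
qed

lemma normal_density_sq_moment:
  assumes "\<sigma> > 0"
  shows "has_bochner_integral lborel (\<lambda>x. normal_density v \<sigma> x * x\<^sup>2) (v\<^sup>2 + \<sigma>\<^sup>2)"
proof -
  have 0: "has_bochner_integral lborel (normal_density v \<sigma>) 1"
    using normal_moment_even[OF assms, of v 0] by simp
  have 1: "has_bochner_integral lborel (\<lambda>x. normal_density v \<sigma> x * (x - v)) 0"
    using normal_moment_odd[OF assms, of v 0] by simp
  have 2: "has_bochner_integral lborel (\<lambda>x. normal_density v \<sigma> x * (x - v)\<^sup>2) (\<sigma>\<^sup>2)"
    using normal_moment_even[OF assms, of v 1] assms by (simp add: fact_numeral)
  have "has_bochner_integral lborel (\<lambda>x. (normal_density v \<sigma> x * v\<^sup>2 + normal_density v \<sigma> x * (x - v) * (2 * v)) + normal_density v \<sigma> x * (x - v)\<^sup>2)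
     ((1 * v\<^sup>2 + 0 * (2 * v)) + \<sigma>\<^sup>2)"
    by (intro has_bochner_integral_add has_bochner_integral_mult_left 0 1 2)
  moreover have "(normal_density v \<sigma> x * v\<^sup>2 + normal_density v \<sigma> x * (x - v) * (2 * v)) + normal_density v \<sigma> x * (x - v)\<^sup>2 = normal_density v \<sigma> x * x\<^sup>2" for x
    by (simp add: power2_eq_square algebra_simps)
  ultimately show ?thesis by simp
qed

text \<open>By \<open>sep\<close> the interaction kernel has row sums at most 2, so the square of
  the sum is pointwise at most \<open>2 / \<sigma>\<close> times a sum of widened densities. The
  moments are then linear in \<open>card V\<close>, as for orthogonal bumps, rather than
  quadratic.\<close>

lemma packet_moments:
  assumes \<sigma>: "\<sigma> > 0" and V: "finite V"
    and sep: "\<And>v. v \<in> V \<Longrightarrow> (\<Sum>u\<in>V. exp (- (v - u)\<^sup>2 / (8 * \<sigma>\<^sup>2))) \<le> 2"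
    and R: "\<sigma> \<le> R" "\<And>v. v \<in> V \<Longrightarrow> \<bar>v\<bar> \<le> R"
  defines "P \<equiv> \<lambda>\<xi>. (\<Sum>v\<in>V. normal_density v \<sigma> \<xi>)"
  defines "M \<equiv> 2 * real (card V) / \<sigma>"
  shows "integrable lborel (\<lambda>\<xi>. (P \<xi>)\<^sup>2)" "integrable lborel (\<lambda>\<xi>. \<xi>\<^sup>2 * (P \<xi>)\<^sup>2)"
    "(LINT \<xi>|lborel. (P \<xi>)\<^sup>2) \<le> M" "(LINT \<xi>|lborel. \<xi>\<^sup>2 * (P \<xi>)\<^sup>2) \<le> 3 * R\<^sup>2 * M"
proof -
  define B where "B = (\<lambda>\<xi>. 2 / \<sigma> * (\<Sum>v\<in>V. normal_density v (sqrt 2 * \<sigma>) \<xi>))"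
  have PB: "(P \<xi>)\<^sup>2 \<le> B \<xi>" for \<xi>
  proof -
    have "(P \<xi>)\<^sup>2 = (\<Sum>v\<in>V. \<Sum>u\<in>V. normal_density v \<sigma> \<xi> * normal_density u \<sigma> \<xi>)"
      unfolding P_def power2_eq_square sum_product ..
    also have "\<dots> \<le> (\<Sum>v\<in>V. \<Sum>u\<in>V. 1 / \<sigma> * (normal_density v (sqrt 2 * \<sigma>) \<xi> * exp (- (v - u)\<^sup>2 / (8 * \<sigma>\<^sup>2))))"
      by (intro sum_mono normal_density_mult_le \<sigma>)
    also have "\<dots> = (\<Sum>v\<in>V. 1 / \<sigma> * normal_density v (sqrt 2 * \<sigma>) \<xi> * (\<Sum>u\<in>V. exp (- (v - u)\<^sup>2 / (8 * \<sigma>\<^sup>2))))"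
      by (simp only: sum_distrib_left mult.assoc)
    also have "\<dots> \<le> (\<Sum>v\<in>V. 1 / \<sigma> * normal_density v (sqrt 2 * \<sigma>) \<xi> * 2)"
      using \<sigma> by (intro sum_mono mult_left_mono sep) auto
    also have "\<dots> = B \<xi>"
      unfolding B_def by (simp add: sum_distrib_left mult_ac)
    finally show ?thesis .
  qed
  have s2: "sqrt 2 * \<sigma> > 0" using \<sigma> by simp
  have B0: "has_bochner_integral lborel B (2 / \<sigma> * (\<Sum>v\<in>V. 1))"
    unfolding B_def using normal_moment_even[OF s2, of _ 0]
    by (intro has_bochner_integral_mult_right has_bochner_integral_sum) auto
  have "has_bochner_integral lborel (\<lambda>\<xi>. 2 / \<sigma> * (\<Sum>v\<in>V. normal_density v (sqrt 2 * \<sigma>) \<xi> * \<xi>\<^sup>2)) (2 / \<sigma> * (\<Sum>v\<in>V. v\<^sup>2 + (sqrt 2 * \<sigma>)\<^sup>2))"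
    by (intro has_bochner_integral_mult_right has_bochner_integral_sum normal_density_sq_moment s2)
  then have B2: "has_bochner_integral lborel (\<lambda>\<xi>. \<xi>\<^sup>2 * B \<xi>) (2 / \<sigma> * (\<Sum>v\<in>V. v\<^sup>2 + (sqrt 2 * \<sigma>)\<^sup>2))"
    unfolding B_def by (simp add: sum_distrib_left mult_ac)
  have [measurable]: "P \<in> borel_measurable borel"
    unfolding P_def by measurable
  have PB2: "\<xi>\<^sup>2 * (P \<xi>)\<^sup>2 \<le> \<xi>\<^sup>2 * B \<xi>" for \<xi>
    by (intro mult_left_mono PB) auto
  have B_nonneg: "0 \<le> B \<xi>" for \<xi>
    using order_trans[OF zero_le_power2 PB] .
  show I0: "integrable lborel (\<lambda>\<xi>. (P \<xi>)\<^sup>2)"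
    by (rule Bochner_Integration.integrable_bound[OF integrable.intros[OF B0]]) (use PB B_nonneg in auto)
  show I2: "integrable lborel (\<lambda>\<xi>. \<xi>\<^sup>2 * (P \<xi>)\<^sup>2)"
    by (rule Bochner_Integration.integrable_bound[OF integrable.intros[OF B2]]) (use PB2 B_nonneg in \<open>auto simp: abs_mult\<close>)
  have "(LINT \<xi>|lborel. (P \<xi>)\<^sup>2) \<le> (LINT \<xi>|lborel. B \<xi>)"
    by (intro integral_mono I0 integrable.intros[OF B0] PB)
  then show "(LINT \<xi>|lborel. (P \<xi>)\<^sup>2) \<le> M"
    using has_bochner_integral_integral_eq[OF B0] by (simp add: M_def)
  have "(LINT \<xi>|lborel. \<xi>\<^sup>2 * (P \<xi>)\<^sup>2) \<le> (LINT \<xi>|lborel. \<xi>\<^sup>2 * B \<xi>)"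
    by (intro integral_mono I2 integrable.intros[OF B2] PB2)
  also have "\<dots> = 2 / \<sigma> * (\<Sum>v\<in>V. v\<^sup>2 + (sqrt 2 * \<sigma>)\<^sup>2)"
    using has_bochner_integral_integral_eq[OF B2] .
  \<comment> \<open>The 3 is one \<open>R^2\<close> for the centre \<open>v\<close> and two for the
    doubled variance \<open>2 * \<sigma>^2\<close>.\<close>
  also have "\<dots> \<le> 2 / \<sigma> * (\<Sum>v\<in>V. 3 * R\<^sup>2)"
  proof (intro mult_left_mono sum_mono)
    fix v assume "v \<in> V"
    then have "v\<^sup>2 \<le> R\<^sup>2" using R(2) abs_le_square_iff[of v R] by force
    moreover have "\<sigma>\<^sup>2 \<le> R\<^sup>2" using R(1) \<sigma> by (intro power_mono) auto
    ultimately show "v\<^sup>2 + (sqrt 2 * \<sigma>)\<^sup>2 \<le> 3 * R\<^sup>2"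
      by (simp add: power_mult_distrib)
  qed (use \<sigma> in auto)
  also have "\<dots> = 3 * R\<^sup>2 * M" by (simp add: M_def)
  finally show "(LINT \<xi>|lborel. \<xi>\<^sup>2 * (P \<xi>)\<^sup>2) \<le> 3 * R\<^sup>2 * M" .
qed

lemma powr_le_one_plus:
  assumes "0 \<le> (u::real)" "0 < s" "s < 1"
  shows "u powr s \<le> 1 + u"
proof (cases "u \<le> 1")
  case True
  then show ?thesis using assms powr_mono2[of s u 1] by simp
next
  case False
  then show ?thesis using assms powr_mono[of s 1 u] by simp
qed

text \<open>
  Rescaling by \<open>R\<^sup>2\<close> before applying \<open>powr_le_one_plus\<close> reduces the weight
  \<open>(1 + |\<xi>|\<^sup>2) powr s\<close> to second moments without losing the factor \<open>R powr (2 * s)\<close>.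
\<close>
lemma sobolev_norm_wave_le:
  fixes \<sigma> :: "'n::finite \<Rightarrow> real"
  assumes \<sigma>: "\<And>i. \<sigma> i > 0" and V: "\<And>i. finite (V i)"
    and sep: "\<And>i v. v \<in> V i \<Longrightarrow> (\<Sum>u\<in>V i. exp (- (v - u)\<^sup>2 / (8 * (\<sigma> i)\<^sup>2))) \<le> 2"
    and R: "\<And>i. \<sigma> i \<le> R" "\<And>i v. v \<in> V i \<Longrightarrow> \<bar>v\<bar> \<le> R" "R \<ge> 1"
    and s: "0 < s" "s < 1"
  shows "sobolev_norm s (wave \<sigma> V) \<le>
    R powr s * sqrt ((2 * pi) ^ CARD('n) * (2 + 3 * real CARD('n)) * (\<Prod>i\<in>UNIV. 2 * real (card (V i)) / \<sigma> i))"
proof -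
  define P where "P i \<xi> = (\<Sum>v\<in>V i. normal_density v (\<sigma> i) \<xi>)" for i \<xi>
  define M where "M i = 2 * real (card (V i)) / \<sigma> i" for i
  note mom = packet_moments[OF \<sigma> V sep R(1) R(2), folded P_def M_def]
  let ?n = "CARD('n)"
  \<comment> \<open>Placing the weight in the single factor \<open>j\<close> turns
    \<open>|\<xi>|^2\<close> times a product into a sum over \<open>j\<close> of products, each
    integrated coordinate by coordinate.\<close>
  define h where "h j i \<xi> = (if i = j then \<xi>\<^sup>2 else 1) * (P i \<xi>)\<^sup>2" for j i :: 'n and \<xi>
  have P0: "has_bochner_integral lborel (\<lambda>\<xi>::real^'n. \<Prod>i\<in>UNIV. (P i (\<xi> $ i))\<^sup>2) (\<Prod>i\<in>UNIV. LINT \<xi>|lborel. (P i \<xi>)\<^sup>2)"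
    by (rule has_bochner_integral_vec_prod) (rule mom)
  have Ih: "integrable lborel (h j i)" for j i
    unfolding h_def by (cases "i = j") (use mom in auto)
  have Pj: "has_bochner_integral lborel (\<lambda>\<xi>::real^'n. \<Prod>i\<in>UNIV. h j i (\<xi> $ i)) (\<Prod>i\<in>UNIV. LINT \<xi>|lborel. h j i \<xi>)" for j
    by (rule has_bochner_integral_vec_prod) (rule Ih)
  have hj: "(\<Prod>i\<in>UNIV. h j i (\<xi> $ i)) = (\<xi> $ j)\<^sup>2 * (\<Prod>i\<in>UNIV. (P i (\<xi> $ i))\<^sup>2)" for j and \<xi> :: "real^'n"
    unfolding h_def prod.distrib by (simp add: prod.delta)
  have le0: "(\<Prod>i\<in>UNIV. LINT \<xi>|lborel. (P i \<xi>)\<^sup>2) \<le> (\<Prod>i\<in>UNIV. M i)"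
    by (intro prod_mono conjI mom) auto
  have lej: "(\<Prod>i\<in>UNIV. LINT \<xi>|lborel. h j i \<xi>) \<le> 3 * R\<^sup>2 * (\<Prod>i\<in>UNIV. M i)" for j
  proof -
    have "(\<Prod>i\<in>UNIV. LINT \<xi>|lborel. h j i \<xi>) \<le> (\<Prod>i\<in>UNIV. (if i = j then 3 * R\<^sup>2 else 1) * M i)"
    proof (intro prod_mono conjI)
      fix i
      show "0 \<le> (LINT \<xi>|lborel. h j i \<xi>)" by (simp add: h_def)
      show "(LINT \<xi>|lborel. h j i \<xi>) \<le> (if i = j then 3 * R\<^sup>2 else 1) * M i"
        unfolding h_def using mom[of i] by auto
    qed
    then show ?thesis by (simp add: prod.distrib prod.delta)
  qed
  let ?W = "\<lambda>\<xi>::real^'n. R powr (2 * s) * (2 * pi) ^ (2 * ?n) *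
     (2 * (\<Prod>i\<in>UNIV. (P i (\<xi> $ i))\<^sup>2) + (\<Sum>j\<in>UNIV. \<Prod>i\<in>UNIV. h j i (\<xi> $ i)) / R\<^sup>2)"
  have W: "has_bochner_integral lborel ?W (R powr (2 * s) * (2 * pi) ^ (2 * ?n) *
     (2 * (\<Prod>i\<in>UNIV. LINT \<xi>|lborel. (P i \<xi>)\<^sup>2) + (\<Sum>j\<in>UNIV. \<Prod>i\<in>UNIV. LINT \<xi>|lborel. h j i \<xi>) / R\<^sup>2))"
    by (intro has_bochner_integral_mult_right has_bochner_integral_add has_bochner_integral_divide_zero has_bochner_integral_sum P0 Pj)
  have point: "(1 + (norm \<xi>)\<^sup>2) powr s * (cmod (fourier (wave \<sigma> V) \<xi>))\<^sup>2 \<le> ?W \<xi>" for \<xi>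
  proof -
    have n2: "(norm \<xi>)\<^sup>2 = (\<Sum>j\<in>UNIV. (\<xi> $ j)\<^sup>2)"
      by (rule power2_norm_vec)
    have F: "(cmod (fourier (wave \<sigma> V) \<xi>))\<^sup>2 = (2 * pi) ^ (2 * ?n) * (\<Prod>i\<in>UNIV. (P i (\<xi> $ i))\<^sup>2)"
    proof -
      have "fourier (wave \<sigma> V) \<xi> = complex_of_real (\<Prod>i\<in>UNIV. 2 * pi * P i (\<xi> $ i))"
        unfolding fourier_wave[OF \<sigma> V] P_def by simp
      then have "(cmod (fourier (wave \<sigma> V) \<xi>))\<^sup>2 = (\<Prod>i\<in>UNIV. 2 * pi * P i (\<xi> $ i))\<^sup>2"
        by (simp only: norm_of_real power2_abs)
      also have "\<dots> = (2 * pi) ^ (2 * ?n) * (\<Prod>i\<in>UNIV. (P i (\<xi> $ i))\<^sup>2)"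
        by (simp add: prod_power_distrib prod.distrib power_mult_distrib power_mult[symmetric] mult.commute)
      finally show ?thesis .
    qed
    have "(1 + (norm \<xi>)\<^sup>2) powr s = R powr (2 * s) * ((1 + (norm \<xi>)\<^sup>2) / R\<^sup>2) powr s"
    proof -
      have "(R\<^sup>2) powr s = R powr (2 * s)"
        using R(3) by (simp add: powr_powr flip: powr_numeral)
      then show ?thesis
        using R(3) by (simp add: powr_divide)
    qed
    also have "\<dots> \<le> R powr (2 * s) * (1 + (1 + (norm \<xi>)\<^sup>2) / R\<^sup>2)"
      using s by (intro mult_left_mono powr_le_one_plus) auto
    also have "\<dots> \<le> R powr (2 * s) * (2 + (norm \<xi>)\<^sup>2 / R\<^sup>2)"
      using R(3) by (intro mult_left_mono) (auto simp: add_divide_distrib)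
    finally have "(1 + (norm \<xi>)\<^sup>2) powr s * (cmod (fourier (wave \<sigma> V) \<xi>))\<^sup>2 \<le>
      R powr (2 * s) * (2 + (norm \<xi>)\<^sup>2 / R\<^sup>2) * ((2 * pi) ^ (2 * ?n) * (\<Prod>i\<in>UNIV. (P i (\<xi> $ i))\<^sup>2))"
      unfolding F by (intro mult_right_mono mult_nonneg_nonneg prod_nonneg) auto
    also have "\<dots> = ?W \<xi>"
      unfolding hj sum_distrib_right[symmetric] n2[symmetric] by (simp add: algebra_simps)
    finally show ?thesis .
  qed
  define A where "A = (\<Prod>i\<in>UNIV. M i)"
  have "(LINT \<xi>|lborel. (1 + (norm \<xi>)\<^sup>2) powr s * (cmod (fourier (wave \<sigma> V) \<xi>))\<^sup>2) \<le> (LINT \<xi>|lborel. ?W \<xi>)"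
  proof (rule integral_mono'[OF integrable.intros[OF W] point])
    show "0 \<le> ?W \<xi>" for \<xi>
      by (rule order_trans[OF _ point]) simp
  qed
  also have "\<dots> = R powr (2 * s) * (2 * pi) ^ (2 * ?n) *
     (2 * (\<Prod>i\<in>UNIV. LINT \<xi>|lborel. (P i \<xi>)\<^sup>2) + (\<Sum>j\<in>UNIV. \<Prod>i\<in>UNIV. LINT \<xi>|lborel. h j i \<xi>) / R\<^sup>2)"
    using has_bochner_integral_integral_eq[OF W] .
  also have "\<dots> \<le> R powr (2 * s) * (2 * pi) ^ (2 * ?n) * (2 * A + (\<Sum>j\<in>(UNIV::'n set). 3 * R\<^sup>2 * A) / R\<^sup>2)"
    unfolding A_def by (intro mult_left_mono add_mono divide_right_mono sum_mono le0 lej) auto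
  also have "2 * A + (\<Sum>j\<in>(UNIV::'n set). 3 * R\<^sup>2 * A) / R\<^sup>2 = (2 + 3 * real ?n) * A"
    using R(3) by (simp add: field_simps)
  finally have I: "(LINT \<xi>|lborel. (1 + (norm \<xi>)\<^sup>2) powr s * (cmod (fourier (wave \<sigma> V) \<xi>))\<^sup>2)
    \<le> R powr (2 * s) * (2 * pi) ^ (2 * ?n) * ((2 + 3 * real ?n) * A)" .
  have "sobolev_norm s (wave \<sigma> V) \<le> sqrt (1 / (2 * pi) ^ ?n * (R powr (2 * s) * (2 * pi) ^ (2 * ?n) * ((2 + 3 * real ?n) * A)))"
    unfolding sobolev_norm_def by (intro real_sqrt_le_mono mult_left_mono I) auto
  also have "1 / (2 * pi) ^ ?n * (R powr (2 * s) * (2 * pi) ^ (2 * ?n) * ((2 + 3 * real ?n) * A)) =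
    (R powr s)\<^sup>2 * ((2 * pi) ^ ?n * (2 + 3 * real ?n) * A)"
  proof -
    have 1: "R powr (2 * s) = (R powr s)\<^sup>2"
      by (metis powr_add mult_2 power2_eq_square)
    have 2: "(2 * pi) ^ (2 * ?n) = (2 * pi) ^ ?n * (2 * pi) ^ ?n"
      by (simp only: mult_2 power_add)
    show ?thesis unfolding 1 2 by simp
  qed
  also have "sqrt \<dots> = R powr s * sqrt ((2 * pi) ^ ?n * (2 + 3 * real ?n) * A)"
    by (subst real_sqrt_mult) simp
  finally show ?thesis
    unfolding A_def M_def .
qed

section \<open>Quadratic Gauss sums\<close>

lemma sum_periodic_shift:
  fixes F :: "nat \<Rightarrow> 'a::ab_group_add"
  assumes "\<And>m. F (m + N) = F m"
  shows "(\<Sum>h<N. F (m + h)) = (\<Sum>h<N. F h)"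
proof (induction m)
  case (Suc m)
  have "(\<Sum>h<N. F (Suc m + h)) = (\<Sum>h<N. F (m + h)) + (F (m + N) - F m)"
    using sum_lessThan_telescope[of "\<lambda>h. F (m + h)" N] by (simp add: sum_subtractf algebra_simps)
  then show ?case using Suc assms by simp
qed simp

definition echar :: "real \<Rightarrow> complex" where
  "echar x = cis (2 * pi * x)"

lemma echar_add: "echar (x + y) = echar x * echar y"
  by (simp add: echar_def cis_mult distrib_left)

lemma echar_0 [simp]: "echar 0 = 1"
  by (simp add: echar_def)

lemma norm_echar [simp]: "norm (echar x) = 1"
  by (simp add: echar_def)

lemma cnj_echar: "cnj (echar x) = echar (- x)"
  by (simp add: echar_def cis_cnj)

lemma echar_int [simp]: "echar (of_int k) = 1"
  using cis_multiple_2pi[of "of_int k"] by (simp add: echar_def)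

lemma echar_eq_1_iff: "echar x = 1 \<longleftrightarrow> x \<in> \<int>"
proof
  assume "echar x = 1"
  then have "cos (2 * pi * x) = 1"
    by (simp add: echar_def complex_eq_iff)
  then obtain k :: int where "2 * pi * x = of_int k * 2 * pi"
    by (auto simp: cos_one_2pi_int)
  then show "x \<in> \<int>" by auto
qed (auto elim: Ints_cases)

lemma echar_power: "echar x ^ m = echar (real m * x)"
  by (simp add: echar_def Complex.DeMoivre algebra_simps)

lemma echar_orthogonality:
  fixes k :: int
  assumes "N > 0"
  shows "(\<Sum>m<N. echar (of_int k * real m / real N)) = (if int N dvd k then of_nat N else 0)"
proof -
  have pw: "echar (of_int k * real m / real N) = echar (of_int k / real N) ^ m" for m
    by (simp add: echar_power algebra_simps)
  have iff: "echar (of_int k / real N) = 1 \<longleftrightarrow> int N dvd k"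
  proof -
    have "of_int k / real N \<in> \<int> \<longleftrightarrow> int N dvd k"
      using assms of_int_div_of_int_in_Ints_iff[of k "int N", where ?'a = real] by simp
    then show ?thesis by (simp add: echar_eq_1_iff)
  qed
  show ?thesis
  proof (cases "int N dvd k")
    case True
    then show ?thesis unfolding pw using iff by simp
  next
    case False
    have "echar (of_int k / real N) ^ N = 1"
      using assms by (simp add: echar_power)
    then show ?thesis unfolding pw using iff False
      by (simp add: geometric_sum)
  qed
qed

definition gphase :: "nat \<Rightarrow> nat \<Rightarrow> int \<Rightarrow> nat \<Rightarrow> complex" where
  "gphase N p c m = echar (of_int (int p * (int m)\<^sup>2 + c * int m) / real N)"

lemma norm_gphase [simp]: "norm (gphase N p c m) = 1"
  by (simp add: gphase_def)

lemma gphase_periodic: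
  assumes "N > 0"
  shows "gphase N p c (m + N) = gphase N p c m"
proof -
  have "of_int (int p * (int (m + N))\<^sup>2 + c * int (m + N)) / real N =
    of_int (int p * (int m)\<^sup>2 + c * int m) / real N + of_int (2 * int p * int m + int p * int N + c)"
    using assms by (simp add: field_simps power2_eq_square)
  then show ?thesis
    unfolding gphase_def by (simp only: echar_add echar_int mult_1_right)
qed

lemma gphase_add:
  "gphase N p c (m + h) * cnj (gphase N p c m) = gphase N p c h * echar (of_int (2 * int p * int h) * real m / real N)"
proof -
  have "of_int (int p * (int (m + h))\<^sup>2 + c * int (m + h)) / real N + - (of_int (int p * (int m)\<^sup>2 + c * int m) / real N) =
    of_int (int p * (int h)\<^sup>2 + c * int h) / real N + of_int (2 * int p * int h) * real m / real N"
    by (simp add: add_divide_distrib[symmetric] diff_divide_distrib[symmetric] power2_eq_square algebra_simps)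
  then show ?thesis
    unfolding gphase_def cnj_echar echar_add[symmetric] by simp
qed

text \<open>Squaring and writing the other index as \<open>m + h\<close> makes the phase linear in
  \<open>m\<close>. The sum over \<open>m\<close> vanishes unless \<open>4 q\<close> divides
  \<open>2 p h\<close>, and for \<open>p\<close> coprime to \<open>4 q\<close> this leaves
  \<open>h = 0\<close> and \<open>h = 2 q\<close> only.\<close>

lemma gauss_sum_norm_sq:
  assumes "q > 0" "coprime p (4 * q)"
  shows "complex_of_real ((norm (\<Sum>m<4*q. gphase (4*q) p c m))\<^sup>2) = of_nat (4 * q) * (1 + gphase (4*q) p c (2*q))"
proof -
  define N where "N = 4 * q"
  have N: "N > 0" using assms by (simp add: N_def)
  let ?g = "gphase N p c"
  have dv: "int N dvd 2 * int p * int h \<longleftrightarrow> h = 0 \<or> h = 2 * q" if "h < N" for h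
  proof -
    have "int N dvd 2 * int p * int h \<longleftrightarrow> N dvd 2 * p * h"
      by (metis int_dvd_int_iff of_nat_mult of_nat_numeral)
    also have "\<dots> \<longleftrightarrow> 2 * (2 * q) dvd 2 * (p * h)"
      by (simp add: N_def mult.assoc)
    also have "\<dots> \<longleftrightarrow> 2 * q dvd p * h" by (subst nat_mult_dvd_cancel_disj) auto
    also have "\<dots> \<longleftrightarrow> 2 * q dvd h"
    proof -
      have "coprime (2 * q) p" using assms(2)
        by (metis coprime_commute coprime_mult_right_iff mult_2 numeral_Bit0 distrib_right coprime_divisors dvd_triv_left dvd_triv_right dvd_refl)
      then show ?thesis by (rule coprime_dvd_mult_right_iff)
    qed
    also have "\<dots> \<longleftrightarrow> h = 0 \<or> h = 2 * q"
    proof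
      assume "2 * q dvd h"
      then obtain k where k: "h = 2 * q * k" by (elim dvdE)
      then have "k < 2" using that assms unfolding N_def by (cases "k < 2") auto
      then show "h = 0 \<or> h = 2 * q" using k by (cases k) auto
    qed auto
    finally show ?thesis .
  qed
  have "complex_of_real ((norm (\<Sum>m<N. ?g m))\<^sup>2) = (\<Sum>m<N. ?g m) * cnj (\<Sum>m<N. ?g m)"
    by (metis complex_norm_square)
  also have "\<dots> = (\<Sum>m<N. (\<Sum>h<N. ?g h) * cnj (?g m))"
    by (simp add: sum_distrib_left)
  also have "\<dots> = (\<Sum>m<N. (\<Sum>h<N. ?g (m + h)) * cnj (?g m))"
    by (subst sum_periodic_shift) (auto simp: gphase_periodic N)
  also have "\<dots> = (\<Sum>m<N. \<Sum>h<N. ?g h * echar (of_int (2 * int p * int h) * real m / real N))"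
    by (simp only: sum_distrib_right gphase_add)
  also have "\<dots> = (\<Sum>h<N. ?g h * (\<Sum>m<N. echar (of_int (2 * int p * int h) * real m / real N)))"
    by (subst sum.swap) (simp only: sum_distrib_left)
  also have "\<dots> = (\<Sum>h<N. ?g h * (if h = 0 \<or> h = 2 * q then of_nat N else 0))"
    by (intro sum.cong refl, subst echar_orthogonality[OF N]) (use dv in auto)
  also have "\<dots> = (\<Sum>h\<in>{0, 2*q}. ?g h * of_nat N)"
    by (intro sum.mono_neutral_cong_right) (use assms in \<open>auto simp: N_def\<close>)
  also have "\<dots> = of_nat N * (1 + ?g (2*q))"
    using assms by (simp add: gphase_def algebra_simps)
  finally show ?thesis unfolding N_def .
qed

lemma gauss_sum_norm_le:
  assumes "q > 0" "coprime p (4 * q)"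
  shows "norm (\<Sum>m<4*q. gphase (4*q) p c m) \<le> sqrt (8 * real q)"
proof -
  have "(norm (\<Sum>m<4*q. gphase (4*q) p c m))\<^sup>2 = norm (of_nat (4 * q) * (1 + gphase (4*q) p c (2*q)))"
    unfolding gauss_sum_norm_sq[OF assms, symmetric] by (simp only: norm_of_real abs_power2)
  also have "\<dots> \<le> real (4 * q) * 2"
    unfolding norm_mult norm_of_nat using norm_triangle_ineq[of 1 "gphase (4*q) p c (2*q)"]
    by (intro mult_left_mono) auto
  finally show ?thesis
    by (intro real_le_rsqrt) simp
qed

text \<open>
  With modulus \<open>4 q\<close> and linear coefficient \<open>4 a\<close> the sum cannot vanish for parity reasons, so
  odd and even \<open>q\<close> need no separate treatment.
\<close>
lemma gauss_sum_norm_eq: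
  assumes "q > 0" "coprime p (4 * q)"
  shows "norm (\<Sum>m<4*q. gphase (4*q) p (4 * a) m) = sqrt (8 * real q)"
proof -
  have "of_int (int p * (int (2 * q))\<^sup>2 + 4 * a * int (2 * q)) / real (4 * q) = of_int (int p * int q + 2 * a)"
    using assms by (simp add: field_simps power2_eq_square)
  then have "gphase (4*q) p (4 * a) (2*q) = 1"
    unfolding gphase_def by (simp only: echar_int)
  then have "complex_of_real ((norm (\<Sum>m<4*q. gphase (4*q) p (4 * a) m))\<^sup>2) = complex_of_real (8 * real q)"
    unfolding gauss_sum_norm_sq[OF assms] by simp
  then have "(norm (\<Sum>m<4*q. gphase (4*q) p (4 * a) m))\<^sup>2 = 8 * real q"
    by (simp only: of_real_eq_iff)
  then show ?thesis by (metis norm_ge_zero real_sqrt_unique)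
qed

section \<open>Incomplete and weighted Gauss sums\<close>

text \<open>On each half of the interval the sine lies above its chord. The symmetric form
  \<open>x * (1 - x)\<close> is chosen because its reciprocal splits into
  \<open>1 / x + 1 / (1 - x)\<close>.\<close>

lemma sin_pi_ge:
  assumes "0 < x" "x < 1"
  shows "2 * (x * (1 - x)) \<le> sin (pi * x)"
proof -
  have "concave_on {0..pi} sin"
    by (rule f''_le0_imp_concave[where f' = cos and f'' = "\<lambda>x. - sin x"])
      (auto intro!: derivative_eq_intros sin_ge_zero)
  note chord = concave_onD[OF this]
  have *: "2 * y \<le> sin (pi * y)" if "0 < y" "y \<le> 1/2" for y
    using chord[of "2 * y" 0 "pi / 2"] that by (simp add: mult.commute)
  show ?thesis
  proof (cases "x \<le> 1/2")
    case True
    have "2 * (x * (1 - x)) \<le> 2 * x" using assms by (simp add: algebra_simps)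
    then show ?thesis using *[of x] True assms by linarith
  next
    case False
    have "x * (1 - x) \<le> 1 * (1 - x)" using assms by (intro mult_right_mono) auto
    then have "2 * (x * (1 - x)) \<le> 2 * (1 - x)" by linarith
    also have "\<dots> \<le> sin (pi * (1 - x))" using False assms by (intro *) auto
    also have "\<dots> = sin (pi * x)" by (simp add: right_diff_distrib sin_diff)
    finally show ?thesis .
  qed
qed

lemma norm_echar_minus_1: "norm (echar x - 1) = 2 * \<bar>sin (pi * x)\<bar>"
proof -
  have "(norm (echar x - 1))\<^sup>2 = (cos (2 * pi * x) - 1)\<^sup>2 + (sin (2 * pi * x))\<^sup>2"
    by (simp add: cmod_power2 echar_def)
  also have "\<dots> = 2 - 2 * cos (2 * (pi * x))"
    using sin_cos_squared_add[of "2 * pi * x"] by (simp add: power2_diff mult.assoc)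
  also have "\<dots> = (2 * \<bar>sin (pi * x)\<bar>)\<^sup>2"
    by (simp add: cos_double_sin power_mult_distrib)
  finally have "(norm (echar x - 1))\<^sup>2 = (2 * \<bar>sin (pi * x)\<bar>)\<^sup>2" .
  then show ?thesis by (metis abs_ge_zero mult_nonneg_nonneg norm_ge_zero power2_eq_iff_nonneg zero_le_numeral)
qed

text \<open>A geometric sum is at most 2 over the distance of its ratio from 1. The bound is
  independent of \<open>r\<close>, and both of its parts sum to harmonic numbers over
  \<open>k\<close>.\<close>

lemma geometric_echar_bound:
  assumes "0 < k" "k < N"
  shows "norm (\<Sum>j<r. echar (- (real k * real j / real N))) \<le> real N / 2 * (1 / real k + 1 / real (N - k))"
proof -
  define x where "x = real k / real N"
  have x: "0 < x" "x < 1" using assms by (auto simp: x_def)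
  have "(\<Sum>j<r. echar (- (real k * real j / real N))) = (\<Sum>j<r. cnj (echar x ^ j))"
    by (simp add: echar_power cnj_echar x_def mult.commute)
  also have "norm \<dots> = norm (\<Sum>j<r. echar x ^ j)"
    by (metis cnj_sum complex_mod_cnj)
  also have ne: "echar x \<noteq> 1" using norm_echar_minus_1[of x] sin_pi_ge[OF x] x
    by (auto simp: mult_le_0_iff)
  then have "norm (\<Sum>j<r. echar x ^ j) = norm (echar x ^ r - 1) / norm (echar x - 1)"
    by (simp add: geometric_sum norm_divide)
  also have "\<dots> \<le> 2 / (2 * (2 * (x * (1 - x))))"
  proof (intro frac_le)
    show "norm (echar x ^ r - 1) \<le> 2"
      using norm_triangle_ineq4[of "echar x ^ r" 1] by (simp add: norm_power)
    show "2 * (2 * (x * (1 - x))) \<le> norm (echar x - 1)"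
      unfolding norm_echar_minus_1 using sin_pi_ge[OF x] by linarith
  qed (use x in auto)
  also have "\<dots> = 1 / 2 * (1 / x + 1 / (1 - x))"
    using x by (simp add: field_simps)
  also have "\<dots> = real N / 2 * (1 / real k + 1 / real (N - k))"
  proof -
    have "1 - x = real (N - k) / real N" using assms by (simp add: x_def of_nat_diff field_simps)
    then have "1 / (1 - x) = real N / real (N - k)" by simp
    moreover have "1 / x = real N / real k" by (simp add: x_def)
    ultimately show ?thesis by (simp add: algebra_simps)
  qed
  finally show ?thesis .
qed

text \<open>
  Completion: the indicator of \<open>{..<r}\<close> is expanded in additive characters modulo \<open>4 q\<close>, each
  of which only shifts the linear coefficient of a complete sum.
\<close>
lemma incomplete_gauss_sum:
  assumes "q > 0" "coprime p (4 * q)" "r \<le> 4 * q"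
  shows "norm (\<Sum>m<r. gphase (4*q) p c m) \<le> sqrt (8 * real q) * (1 + harm (4 * q))"
proof -
  define N where "N = 4 * q"
  have N: "N > 0" using assms by (simp add: N_def)
  let ?g = "gphase N p"
  have shift: "?g c m * echar (real k * real m / real N) = ?g (c + int k) m" for k m
    unfolding gphase_def echar_add[symmetric] by (simp add: add_divide_distrib[symmetric] algebra_simps)
  have delta: "(\<Sum>k<N. echar (- (real k * real j / real N)) * echar (real k * real m / real N)) = (if m = j then of_nat N else 0)"
    if "m < N" "j < N" for m j
  proof -
    have *: "echar (- (real k * real j / real N)) * echar (real k * real m / real N) =
      echar (of_int (int m - int j) * real k / real N)" for k
      unfolding echar_add[symmetric] by (simp add: diff_divide_distrib[symmetric] algebra_simps)
    have "int N dvd (int m - int j) \<longleftrightarrow> m = j"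
      using that by (auto dest: zdvd_imp_le simp: dvd_imp_le_int) (metis mod_eq_dvd_iff mod_less nat_int_comparison(1) of_nat_mod)
    then show ?thesis unfolding * echar_orthogonality[OF N] by simp
  qed
  have "of_nat N * (\<Sum>j<r. ?g c j) = (\<Sum>j<r. \<Sum>m<N. ?g c m * (if m = j then of_nat N else 0))"
    using assms by (simp add: sum_distrib_left N_def sum.delta' if_distrib mult.commute cong: if_cong)
  also have "\<dots> = (\<Sum>j<r. \<Sum>m<N. \<Sum>k<N. echar (- (real k * real j / real N)) * ?g (c + int k) m)"
  proof (intro sum.cong refl)
    fix j m assume "j \<in> {..<r}" "m \<in> {..<N}"
    then have "(if m = j then of_nat N else 0) = (\<Sum>k<N. echar (- (real k * real j / real N)) * echar (real k * real m / real N))"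
      using assms by (subst delta) (auto simp: N_def)
    then show "?g c m * (if m = j then of_nat N else 0) = (\<Sum>k<N. echar (- (real k * real j / real N)) * ?g (c + int k) m)"
      by (simp only: sum_distrib_left shift[symmetric] mult.left_commute)
  qed
  also have "\<dots> = (\<Sum>k<N. (\<Sum>j<r. echar (- (real k * real j / real N))) * (\<Sum>m<N. ?g (c + int k) m))"
    unfolding sum_product
    by (subst (2) sum.swap, subst sum.swap, simp)
  finally have eq: "of_nat N * (\<Sum>j<r. ?g c j) = \<dots>" .
  have "real N * norm (\<Sum>j<r. ?g c j) = norm (of_nat N * (\<Sum>j<r. ?g c j))"
    by (simp add: norm_mult)
  also have "\<dots> \<le> (\<Sum>k<N. norm (\<Sum>j<r. echar (- (real k * real j / real N))) * sqrt (8 * real q))"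
    unfolding eq using gauss_sum_norm_le[OF assms(1,2)] unfolding N_def
    by (intro sum_norm_le) (auto simp: norm_mult intro!: mult_left_mono)
  also have "\<dots> = (\<Sum>k<N. norm (\<Sum>j<r. echar (- (real k * real j / real N)))) * sqrt (8 * real q)"
    by (simp add: sum_distrib_right)
  also have "(\<Sum>k<N. norm (\<Sum>j<r. echar (- (real k * real j / real N)))) \<le> real N * (1 + harm N)"
  proof -
    have "(\<Sum>k<N. norm (\<Sum>j<r. echar (- (real k * real j / real N)))) =
      real r + (\<Sum>k\<in>{1..<N}. norm (\<Sum>j<r. echar (- (real k * real j / real N))))"
      using N by (simp add: sum.atLeast_Suc_lessThan lessThan_atLeast0)
    also have "\<dots> \<le> real N + (\<Sum>k\<in>{1..<N}. real N / 2 * (1 / real k + 1 / real (N - k)))"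
      using assms by (intro add_mono sum_mono geometric_echar_bound) (auto simp: N_def)
    also have "(\<Sum>k\<in>{1..<N}. real N / 2 * (1 / real k + 1 / real (N - k))) = real N / 2 * ((\<Sum>k\<in>{1..<N}. 1 / real k) + (\<Sum>k\<in>{1..<N}. 1 / real (N - k)))"
      by (simp only: sum_distrib_left[symmetric] sum.distrib)
    also have "(\<Sum>k\<in>{1..<N}. 1 / real (N - k)) = (\<Sum>k\<in>{1..<N}. 1 / real k)"
      by (rule sum.reindex_bij_witness[of _ "\<lambda>k. N - k" "\<lambda>k. N - k"]) auto
    also have "(\<Sum>k\<in>{1..<N}. 1 / real k) \<le> harm N"
      unfolding harm_def by (simp add: inverse_eq_divide) (intro sum_mono2, auto)
    finally show ?thesis using N by (simp add: algebra_simps)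
  qed
  finally have "real N * norm (\<Sum>j<r. ?g c j) \<le> real N * (sqrt (8 * real q) * (1 + harm N))"
    by (simp add: mult_right_mono mult_ac)
  then show ?thesis using N unfolding N_def by simp
qed
text \<open>Complete periods follow the linear growth exactly, so the deviation comes from the last
  period alone: one incomplete sum and at most one \<open>G\<close>. The bound does not depend on
  \<open>m\<close>, as partial summation requires.\<close>

lemma gauss_partial_sum_deviation:
  fixes c :: int
  assumes "q > 0" "coprime p (4 * q)"
  defines "G \<equiv> (\<Sum>l<4*q. gphase (4*q) p c l)"
  shows "norm ((\<Sum>l<m. gphase (4*q) p c l) - of_nat m * G / of_nat (4 * q)) \<le> sqrt (8 * real q) * (2 + harm (4 * q))"
proof -
  define N where "N = 4 * q"
  have N: "N > 0" using assms by (simp add: N_def)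
  let ?g = "gphase N p c"
  have GN: "G = (\<Sum>l<N. ?g l)" by (simp add: G_def N_def)
  define u r where "u = m div N" and "r = m mod N"
  have m: "m = u * N + r" by (simp add: u_def r_def)
  have r: "r < N" using N by (simp add: r_def)
  have per: "?g (u * N + l) = ?g l" for u l
  proof (induction u)
    case (Suc u)
    have "Suc u * N + l = (u * N + l) + N" by simp
    then show ?case using Suc gphase_periodic[OF N] by (simp only:)
  qed simp
  have split: "(\<Sum>l<u * N + r. ?g l) = of_nat u * G + (\<Sum>l<r. ?g l)" for u r
  proof -
    have "(\<Sum>l<u * N. ?g l) = of_nat u * G"
    proof (induction u)
      case (Suc u)
      have "(\<Sum>l<u * N + r. ?g l) = (\<Sum>l<u * N. ?g l) + (\<Sum>l<r. ?g (u * N + l))" for r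
        by (induction r) (auto simp: add.assoc)
      from this[of N] have "(\<Sum>l<Suc u * N. ?g l) = (\<Sum>l<u * N. ?g l) + (\<Sum>l<N. ?g (u * N + l))"
        by (simp add: add.commute)
      then show ?case unfolding per GN[symmetric] Suc by (simp add: algebra_simps)
    qed simp
    moreover have "(\<Sum>l<u * N + r. ?g l) = (\<Sum>l<u * N. ?g l) + (\<Sum>l<r. ?g (u * N + l))"
      by (induction r) (auto simp: add.assoc)
    ultimately show ?thesis by (simp add: per)
  qed
  have "(\<Sum>l<m. ?g l) - of_nat m * G / of_nat N = (\<Sum>l<r. ?g l) - of_nat r / of_nat N * G"
    unfolding m split using N by (simp add: field_simps)
  also have "norm \<dots> \<le> norm (\<Sum>l<r. ?g l) + real r / real N * norm G"
    by (rule order_trans[OF norm_triangle_ineq4]) (simp add: norm_mult norm_divide)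
  also have "\<dots> \<le> sqrt (8 * real q) * (1 + harm N) + 1 * sqrt (8 * real q)"
    using r assms(1,2) gauss_sum_norm_le[OF assms(1,2)] incomplete_gauss_sum[OF assms(1,2), of r]
    unfolding G_def N_def by (intro add_mono mult_mono) auto
  finally show ?thesis by (simp add: N_def algebra_simps)
qed

text \<open>Partial summation against the deviation \<open>B\<close> from linear growth. The main
  term is \<open>G / (4 q)\<close> times the sum of the weights, which is at least
  \<open>L / 2\<close> in modulus. The 5/2 collects the boundary term, with weight at most 3/2, and
  the total variation of \<open>w\<close>, at most 1.\<close>

lemma weighted_gauss_sum_ge:
  fixes w :: "nat \<Rightarrow> complex"
  assumes q: "q > 0" "coprime p (4 * q)"
    and w1: "\<And>l. l \<le> L \<Longrightarrow> norm (w l - 1) \<le> 1 / 2"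
    and w2: "\<And>l. l < L \<Longrightarrow> norm (w (Suc l) - w l) \<le> 1 / real L"
  shows "norm (\<Sum>l<L. w l * gphase (4*q) p (4 * a) l) \<ge>
    sqrt (8 * real q) * (real L / (8 * real q) - 5 / 2 * (2 + harm (4 * q)))"
proof -
  let ?g = "gphase (4*q) p (4 * a)"
  define G where "G = (\<Sum>l<4*q. ?g l)"
  define B where "B m = (\<Sum>l<m. ?g l) - of_nat m * G / of_nat (4 * q)" for m
  define E where "E = sqrt (8 * real q) * (2 + harm (4 * q))"
  have B: "norm (B m) \<le> E" for m
    unfolding B_def G_def E_def by (rule gauss_partial_sum_deviation[OF q])
  have E0: "E \<ge> 0" using order_trans[OF norm_ge_zero B] .
  have g: "?g l = B (Suc l) - B l + G / of_nat (4 * q)" for l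
    unfolding B_def by (simp add: add_divide_distrib algebra_simps)
  have abel: "(\<Sum>l<m. w l * (B (Suc l) - B l)) = w m * B m - (\<Sum>l<m. (w (Suc l) - w l) * B (Suc l))" for m
    by (induction m) (auto simp: B_def[of 0] algebra_simps)
  have s: "(\<Sum>l<L. w l * (G / of_nat (4 * q))) = G / of_nat (4 * q) * (\<Sum>l<L. w l)"
    by (simp only: sum_distrib_right[symmetric] mult.commute)
  have "(\<Sum>l<L. w l * ?g l) = G / of_nat (4 * q) * (\<Sum>l<L. w l) + (w L * B L - (\<Sum>l<L. (w (Suc l) - w l) * B (Suc l)))"
    unfolding g distrib_left sum.distrib abel s by (rule add.commute)
  then have eq: "norm (\<Sum>l<L. w l * ?g l) \<ge> norm (G / of_nat (4 * q) * (\<Sum>l<L. w l))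
      - norm (w L * B L - (\<Sum>l<L. (w (Suc l) - w l) * B (Suc l)))"
    by (simp only: norm_diff_ineq)
  have "norm (w L * B L - (\<Sum>l<L. (w (Suc l) - w l) * B (Suc l))) \<le> 3 / 2 * E + (\<Sum>l<L. 1 / real L * E)"
  proof (rule order_trans[OF norm_triangle_ineq4 add_mono])
    have "norm (w L) \<le> 3 / 2"
      using norm_triangle_ineq[of "w L - 1" 1] w1[of L] by simp
    then show "norm (w L * B L) \<le> 3 / 2 * E"
      unfolding norm_mult using B by (intro mult_mono) auto
    show "norm (\<Sum>l<L. (w (Suc l) - w l) * B (Suc l)) \<le> (\<Sum>l<L. 1 / real L * E)"
      by (intro sum_norm_le) (auto simp: norm_mult intro!: mult_mono[OF w2 B, simplified])
  qed
  also have "\<dots> \<le> 5 / 2 * E"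
    using E0 by (cases "L = 0") auto
  finally have 2: "norm (w L * B L - (\<Sum>l<L. (w (Suc l) - w l) * B (Suc l))) \<le> 5 / 2 * E" .
  have "real L / 2 \<le> norm (\<Sum>l<L. w l)"
  proof -
    have "norm (\<Sum>l<L. w l - 1) \<le> (\<Sum>l<L. 1 / 2)"
      by (intro sum_norm_le w1) auto
    then have "norm ((\<Sum>l<L. w l) - of_nat L) \<le> real L / 2"
      by (simp add: sum_subtractf)
    then show ?thesis
      using norm_triangle_ineq2[of "of_nat L :: complex" "\<Sum>l<L. w l"] by (simp add: norm_minus_commute)
  qed
  then have "sqrt (8 * real q) / (4 * real q) * (real L / 2) \<le> norm (G / of_nat (4 * q) * (\<Sum>l<L. w l))"
    unfolding norm_mult norm_divide G_def gauss_sum_norm_eq[OF q] norm_of_nat by (intro mult_mono) auto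
  with eq 2 show ?thesis
    unfolding E_def by (simp add: algebra_simps)
qed

section \<open>The density of numerators coprime to the modulus\<close>

text \<open>In increasing order the \<open>i\<close>-th element is at least \<open>i + 1\<close>, so
  the product dominates the telescoping product of \<open>i / (i + 1)\<close>. The induction removes
  the maximum, for which distinctness forces at least \<open>k + 2\<close>.\<close>

lemma prod_one_minus_inverse_ge:
  fixes P :: "nat set"
  assumes "finite P" "\<And>p. p \<in> P \<Longrightarrow> p \<ge> 2"
  shows "(\<Prod>p\<in>P. 1 - 1 / real p) \<ge> 1 / (real (card P) + 1)"
  using assms
proof (induction "card P" arbitrary: P)
  case (Suc k)
  define M where "M = Max P"
  have "P \<noteq> {}" using Suc by auto
  then have M: "M \<in> P" using Suc unfolding M_def by (intro Max_in)
  have "P \<subseteq> {2..M}" using Suc by (auto simp: M_def)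
  then have "card P \<le> M - 1" using card_mono[of "{2..M}" P] by simp
  then have M2: "M \<ge> k + 2" using Suc by linarith
  have IH: "1 / (real k + 1) \<le> (\<Prod>p\<in>P - {M}. 1 - 1 / real p)"
  proof -
    have "card (P - {M}) = k" using Suc M by simp
    then show ?thesis using Suc.hyps(1)[of "P - {M}"] Suc.prems by simp
  qed
  have "1 / (real (card P) + 1) = (1 - 1 / (real k + 2)) * (1 / (real k + 1))"
    using Suc.hyps(2)[symmetric] by (simp add: field_simps)
  also have "\<dots> \<le> (1 - 1 / real M) * (\<Prod>p\<in>P - {M}. 1 - 1 / real p)"
    using IH M2 by (intro mult_mono) (auto simp: frac_le field_simps)
  also have "\<dots> = (\<Prod>p\<in>P. 1 - 1 / real p)"
    using Suc M by (simp add: prod.remove)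
  finally show ?case .
qed simp

text \<open>A number has at most \<open>log 2 N\<close> distinct prime factors, since their product
  with 2 in place of each prime is at most \<open>N\<close>; the Euler product then loses at most a
  logarithm.\<close>

lemma totient_ge:
  assumes "N > 0"
  shows "real (totient N) * (1 + log 2 (real N)) \<ge> real N"
proof -
  let ?P = "prime_factors N"
  have "(2::nat) ^ card ?P = (\<Prod>p\<in>?P. 2)" by simp
  also have "\<dots> \<le> (\<Prod>p\<in>?P. p ^ multiplicity p N)"
  proof (rule prod_mono)
    fix p assume p: "p \<in> ?P"
    then have "p \<ge> 2" "multiplicity p N > 0"
      by (auto simp: prime_ge_2_nat prime_factors_multiplicity)
    then show "0 \<le> (2::nat) \<and> 2 \<le> p ^ multiplicity p N"
      using self_le_power[of p "multiplicity p N"] by simp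
  qed
  also have "\<dots> = N"
    using prod_prime_factors[of N] assms by simp
  finally have "real (2 ^ card ?P) \<le> real N" by linarith
  then have "real (card ?P) \<le> log 2 (real N)"
    using assms by (simp add: le_log_iff powr_realpow)
  moreover have "1 / (real (card ?P) + 1) \<le> (\<Prod>p\<in>?P. 1 - 1 / real p)"
    by (rule prod_one_minus_inverse_ge) (auto intro: prime_ge_2_nat)
  then have "1 \<le> (\<Prod>p\<in>?P. 1 - 1 / real p) * (real (card ?P) + 1)"
    by (simp add: field_simps)
  moreover have "(\<Prod>p\<in>?P. 1 - 1 / real p) \<ge> 0"
  proof (rule prod_nonneg)
    fix p assume "p \<in> ?P"
    then have "p \<ge> 1" using prime_ge_1_nat by blast
    then show "0 \<le> 1 - 1 / real p" by simp
  qed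
  ultimately have "1 \<le> (\<Prod>p\<in>?P. 1 - 1 / real p) * (1 + log 2 (real N))"
    by (smt (verit) mult_left_mono)
  then show ?thesis
    using mult_left_mono[of 1 "(\<Prod>p\<in>?P. 1 - 1 / real p) * (1 + log 2 (real N))" "real N"]
      totient_formula2[of N] by (simp add: mult.assoc)
qed

lemma card_coprime_lessThan:
  assumes "N > 1"
  shows "card {p. p < M * N \<and> coprime p N} = M * totient N"
proof (induction M)
  case (Suc M)
  have cop: "coprime (p + M * N) N \<longleftrightarrow> coprime p N" for p
    using gcd_add_mult[of N M p] by (simp only: coprime_iff_gcd_eq_1 gcd.commute[of _ N] add.commute[of _ "M * N"])
  have "{p. p < Suc M * N \<and> coprime p N} = {p. p < M * N \<and> coprime p N} \<union> (\<lambda>p. p + M * N) ` {p. p < N \<and> coprime p N}"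
  proof (intro Set.set_eqI iffI)
    fix p assume p: "p \<in> {p. p < Suc M * N \<and> coprime p N}"
    show "p \<in> {p. p < M * N \<and> coprime p N} \<union> (\<lambda>p. p + M * N) ` {p. p < N \<and> coprime p N}"
    proof (cases "p < M * N")
      case False
      then have "p = (p - M * N) + M * N" "p - M * N < N" using p by auto
      moreover have "coprime (p - M * N) N" using p calculation(1) cop[of "p - M * N"] by simp
      ultimately show ?thesis by blast
    qed (use p in auto)
  next
    fix p assume "p \<in> {p. p < M * N \<and> coprime p N} \<union> (\<lambda>p. p + M * N) ` {p. p < N \<and> coprime p N}"
    then show "p \<in> {p. p < Suc M * N \<and> coprime p N}"
      by (auto simp: cop)
  qed
  \<comment> \<open>Totatives range over \<open>1..N\<close> and the set over
    \<open>0..N - 1\<close>; for \<open>N > 1\<close> neither 0 nor \<open>N\<close> is coprime to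
    \<open>N\<close>, so the endpoints do not matter.\<close>
  moreover have "{p. p < N \<and> coprime p N} = totatives N"
    using assms by (auto simp: in_totatives_iff totatives_less intro!: Nat.gr0I)
  ultimately show ?case
    using Suc by (simp, subst card_Un_disjoint) (auto simp: card_image totient_def)
qed simp

section \<open>Bourgain's initial datum\<close>

lemma norm_echar_diff_le: "norm (echar x - echar y) \<le> 2 * pi * \<bar>x - y\<bar>"
  using norm_iexp_diff_le[of "2 * pi * x" "2 * pi * y"]
  by (simp add: echar_def cis_conv_exp abs_mult flip: right_diff_distrib)

lemma gauss_osc_near_1: "norm (gauss_osc z s - 1) \<le> \<bar>z\<bar> + \<bar>s\<bar>"
  using gauss_osc_diff[of z s 0 0] by (simp add: gauss_osc_0)

text \<open>The weights are the slowly varying part of a transversal factor: \<open>\<beta>\<close>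
  is the error of the rational approximation, and \<open>d\<close> is the increment in displacement
  from one frequency to the next. The phase turns by at most 1/4 in total and the Gaussian departs
  from 1 by at most 1/16, which covers both requirements on the weights.\<close>

lemma coordinate_sum_ge:
  assumes q: "q > 0" "coprime p (4 * q)" and L: "L > 0"
    and \<beta>: "real L * \<bar>\<beta>\<bar> \<le> 1 / 32" and y: "\<bar>y\<bar> + d * real L + \<bar>t\<bar> \<le> 1 / 16" and d: "d \<ge> 0"
  shows "norm (\<Sum>l<L. (echar (real l * \<beta>) * gauss_osc (y + d * real l) t) * gphase (4*q) p (4 * a) l) \<ge>
    sqrt (8 * real q) * (real L / (8 * real q) - 5 / 2 * (2 + harm (4 * q)))"
proof (rule weighted_gauss_sum_ge[OF q])
  have go: "norm (gauss_osc (y + d * real l) t - 1) \<le> 1 / 16" if "l \<le> L" for l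
  proof -
    have "d * real l \<le> d * real L" using that d by (intro mult_left_mono) auto
    moreover have "0 \<le> d * real l" using d by simp
    ultimately show ?thesis
      using gauss_osc_near_1[of "y + d * real l" t] y abs_triangle_ineq[of y "d * real l"] by linarith
  qed
  have b: "2 * pi * (real L * \<bar>\<beta>\<bar>) \<le> 1 / 4"
  proof -
    have "2 * pi * (real L * \<bar>\<beta>\<bar>) \<le> 8 * (1 / 32)"
      using \<beta> pi_less_4 by (intro mult_mono) auto
    then show ?thesis by simp
  qed
  show "norm (echar (real l * \<beta>) * gauss_osc (y + d * real l) t - 1) \<le> 1 / 2" if "l \<le> L" for l
  proof -
    have "echar (real l * \<beta>) * gauss_osc (y + d * real l) t - 1 =
      echar (real l * \<beta>) * (gauss_osc (y + d * real l) t - 1) + (echar (real l * \<beta>) - echar 0)"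
      by (simp add: algebra_simps)
    also have "norm \<dots> \<le> norm (gauss_osc (y + d * real l) t - 1) + 2 * pi * (real l * \<bar>\<beta>\<bar>)"
      using norm_echar_diff_le[of "real l * \<beta>" 0]
      by (intro order_trans[OF norm_triangle_ineq] add_mono) (auto simp: norm_mult abs_mult)
    also have "2 * pi * (real l * \<bar>\<beta>\<bar>) \<le> 2 * pi * (real L * \<bar>\<beta>\<bar>)"
      using that by (intro mult_left_mono mult_right_mono) auto
    finally show ?thesis using go[OF that] b by linarith
  qed
  show "norm (echar (real (Suc l) * \<beta>) * gauss_osc (y + d * real (Suc l)) t - echar (real l * \<beta>) * gauss_osc (y + d * real l) t)
    \<le> 1 / real L" if "l < L" for l
  proof -
    let ?e = "echar (real l * \<beta>)" and ?e' = "echar (real (Suc l) * \<beta>)"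
    let ?w = "gauss_osc (y + d * real l) t" and ?w' = "gauss_osc (y + d * real (Suc l)) t"
    have "norm ?w' \<le> 17 / 16"
      using norm_triangle_ineq[of "?w' - 1" 1] go[of "Suc l"] that by simp
    then have "norm (?e' - ?e) * norm ?w' \<le> (2 * pi * \<bar>\<beta>\<bar>) * (17 / 16)"
      using norm_echar_diff_le[of "real (Suc l) * \<beta>" "real l * \<beta>"]
      by (intro mult_mono) (auto simp: algebra_simps)
    moreover have "norm (?w' - ?w) \<le> d"
      using gauss_osc_diff[of "y + d * real (Suc l)" t "y + d * real l" t] d by (simp add: algebra_simps)
    moreover have "?e' * ?w' - ?e * ?w = (?e' - ?e) * ?w' + ?e * (?w' - ?w)"
      by (simp add: algebra_simps)
    then have "norm (?e' * ?w' - ?e * ?w) \<le> norm (?e' - ?e) * norm ?w' + norm (?w' - ?w)"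
      using norm_triangle_ineq[of "(?e' - ?e) * ?w'" "?e * (?w' - ?w)"] by (simp add: norm_mult)
    ultimately have "norm (?e' * ?w' - ?e * ?w) \<le> 2 * pi * \<bar>\<beta>\<bar> * (17 / 16) + d" by linarith
    also have "\<dots> \<le> 1 / real L"
    proof -
      have "(2 * pi * \<bar>\<beta>\<bar> * (17 / 16) + d) * real L = 17 / 16 * (2 * pi * (real L * \<bar>\<beta>\<bar>)) + d * real L"
        by (simp add: algebra_simps)
      also have "\<dots> \<le> 1" using b y by linarith
      finally show ?thesis using L by (simp add: field_simps)
    qed
    finally show ?thesis .
  qed
qed

lemma emeasure_lborel_translate:
  fixes c :: "'a::euclidean_space"
  assumes [measurable]: "Z \<in> sets borel"
  shows "emeasure lborel {x. x - c \<in> Z} = emeasure lborel Z"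
proof -
  have "emeasure lborel Z = emeasure (distr lborel borel ((+) (- c))) Z"
    by (simp add: lborel_distr_plus)
  also have "\<dots> = emeasure lborel ((+) (- c) -` Z \<inter> space lborel)"
    by (rule emeasure_distr) auto
  also have "(+) (- c) -` Z \<inter> space lborel = {x. x - c \<in> Z}"
    by auto
  finally show ?thesis by simp
qed

lemma harm_le_ln: "m > 0 \<Longrightarrow> harm m \<le> 1 + ln (real m)"
  using decseqD[OF decseq_harm_diff_ln, of 0 "m - 1"] by (simp add: harm_expand)

text \<open>
  The coordinate \<open>i0\<close> is the longitudinal one. \<open>L\<close> is the number of exponentials in each
  transversal factor and \<open>M\<close> the number of periods modulo \<open>4 q\<close> available to the numerator \<open>p\<close>;
  \<open>K\<close> is a constant large enough to keep all slowly varying factors close to 1, and \<open>T\<close> is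
  a multiple of it only to avoid rounding.
\<close>
locale bourgain =
  fixes T K n k L M u :: nat and i0 :: "'n::finite"
  assumes card: "CARD('n) = n" and n: "n = Suc k" and k: "k \<ge> 1"
    and K: "K = 64 * 4 ^ k" and T: "T = K * u" and u: "u > 0"
    and L: "K * L = T ^ n" and M: "2 * K * M = T\<^sup>2"
begin

lemma K_ge: "K \<ge> 256"
  using power_increasing[OF k, of "4::nat"] by (simp add: K)

lemma T_ge: "T \<ge> K"
  using u by (simp add: T)

lemma T_pos: "T > 0" and K_pos: "K > 0"
  using T_ge K_ge by auto

lemma T_power_ge_1: "1 \<le> real T ^ m"
  using T_pos by (intro one_le_power) simp

lemma L_pos: "L > 0"
  using L T_pos by (metis mult_0_right neq0_conv power_not_zero)

lemma L_real: "real L = real T ^ n / real K"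
  using arg_cong[OF L, of real] K_pos by (simp add: field_simps)

lemma L_le: "real L \<le> real T ^ n"
proof -
  have "1 * L \<le> K * L" using K_pos by (intro mult_right_mono) auto
  then have "L \<le> T ^ n" using L by simp
  then show ?thesis by (metis of_nat_le_iff of_nat_power)
qed

definition \<sigma> :: "'n \<Rightarrow> real" where
  "\<sigma> i = (if i = i0 then real T ^ (n + 1) else 1)"

definition V :: "'n \<Rightarrow> real set" where
  "V i = (if i = i0 then {- (2 * pi * real T ^ (2 * n + 2))} else (\<lambda>l. 2 * pi * real T ^ (n + 2) * real l) ` {..<L})"

lemma \<sigma>_ge_1: "\<sigma> i \<ge> 1"
  unfolding \<sigma>_def using T_pos one_le_power[of "real T" "n + 1"] by simp

lemma \<sigma>_pos: "\<sigma> i > 0"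
  using \<sigma>_ge_1[of i] by linarith

lemma finite_V: "finite (V i)"
  by (simp add: V_def)

text \<open>The tolerance \<open>1 / T\<close> is the one for which Dirichlet's theorem for
  \<open>k\<close> numbers yields a common denominator up to \<open>T ^ k\<close>. Ignoring the
  coordinate \<open>i0\<close> makes the condition invariant under longitudinal translation.\<close>

definition good :: "nat \<Rightarrow> real^'n \<Rightarrow> bool" where
  "good q x \<longleftrightarrow> (\<forall>j. j \<noteq> i0 \<longrightarrow> (\<exists>a::int. \<bar>real q * (real T ^ (n + 2) * x $ j) - of_int a\<bar> < 1 / real T))"

definition amp :: "nat \<Rightarrow> real" where
  "amp q = sqrt (8 * real q) * (real L / (8 * real q) - 5 / 2 * (2 + harm (4 * q)))"

text \<open>For this \<open>t\<close> the quadratic phase at the \<open>l\<close>-th frequency is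
  \<open>2 * pi * p * l^2 / (4 q)\<close>, and approximating the linear phase by
  \<open>a / q\<close> supplies the coefficient \<open>4 * a\<close> over the same modulus. What
  remains is the slow weight of \<open>coordinate_sum_ge\<close>.\<close>

lemma transversal_sum_ge:
  assumes q: "q > 0" "coprime p (4 * q)" "real T ^ k \<le> 2 * 4 ^ k * real q"
    and \<theta>: "\<theta> = real p / (2 * real q * (real T)\<^sup>2)" "\<theta> \<le> 1 / real K"
    and t: "t = \<theta> / (4 * pi * real T ^ (2 * n + 2))"
    and y: "0 \<le> y" "y \<le> 1 / real K" and a: "\<bar>real q * (real T ^ (n + 2) * y) - of_int a\<bar> < 1 / real T"
    and j: "j \<noteq> i0"
  shows "amp q \<le> norm (\<Sum>v\<in>V j. exp (\<i> * complex_of_real (v * y + v\<^sup>2 * t)) * gauss_osc (\<sigma> j * (y + 2 * v * t)) ((\<sigma> j)\<^sup>2 * t))"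
proof -
  define D where "D = 2 * pi * real T ^ (n + 2)"
  define \<beta> where "\<beta> = real T ^ (n + 2) * y - of_int a / real q"
  define d where "d = 2 * D * t"
  have T0: "real T > 0" and K0: "real K > 0" using T_pos K_pos by auto
  have \<theta>0: "\<theta> \<ge> 0" by (simp add: \<theta>)
  have t0: "t \<ge> 0" using \<theta>0 by (simp add: t)
  have D0: "D > 0" using T0 by (simp add: D_def)
  have phase: "exp (\<i> * complex_of_real ((D * real l) * y + (D * real l)\<^sup>2 * t)) = gphase (4*q) p (4 * a) l * echar (real l * \<beta>)" for l
  proof -
    have tq: "D\<^sup>2 * t = 2 * pi * (real p / (4 * real q))"
    proof -
      have "D\<^sup>2 * t = 4 * pi\<^sup>2 * (real T ^ (n + 2))\<^sup>2 * (real p / (2 * real q * (real T)\<^sup>2) / (4 * pi * real T ^ (2 * n + 2)))"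
        by (simp add: D_def t \<theta> power_mult_distrib)
      also have "(real T ^ (n + 2))\<^sup>2 = (real T)\<^sup>2 * real T ^ (2 * n + 2)"
        by (simp add: power_mult[symmetric] power_add[symmetric] algebra_simps)
      finally show ?thesis using T0 q by (simp add: field_simps power2_eq_square)
    qed
    have "(D * real l) * y + (D * real l)\<^sup>2 * t = 2 * pi * (real l * (real T ^ (n + 2) * y)) + (D\<^sup>2 * t) * (real l)\<^sup>2"
      by (simp add: D_def power_mult_distrib algebra_simps)
    also have "\<dots> = 2 * pi * (real l * (real T ^ (n + 2) * y) + real p * (real l)\<^sup>2 / (4 * real q))"
      unfolding tq by (simp add: algebra_simps)
    also have "real l * (real T ^ (n + 2) * y) + real p * (real l)\<^sup>2 / (4 * real q) =
      of_int (int p * (int l)\<^sup>2 + 4 * a * int l) / real (4 * q) + real l * \<beta>"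
      using q by (simp add: \<beta>_def field_simps)
    finally show ?thesis
      unfolding gphase_def echar_add[symmetric] by (simp only: echar_def cis_conv_exp)
  qed
  have "inj_on (\<lambda>l. D * real l) {..<L}"
    using D0 by (auto simp: inj_on_def)
  then have "(\<Sum>v\<in>V j. exp (\<i> * complex_of_real (v * y + v\<^sup>2 * t)) * gauss_osc (\<sigma> j * (y + 2 * v * t)) ((\<sigma> j)\<^sup>2 * t)) =
    (\<Sum>l<L. exp (\<i> * complex_of_real ((D * real l) * y + (D * real l)\<^sup>2 * t)) * gauss_osc (y + 2 * (D * real l) * t) t)"
    unfolding V_def \<sigma>_def D_def[symmetric] using j by (simp add: sum.reindex)
  also have "\<dots> = (\<Sum>l<L. (echar (real l * \<beta>) * gauss_osc (y + d * real l) t) * gphase (4*q) p (4 * a) l)"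
    unfolding phase by (intro sum.cong refl) (simp add: d_def mult_ac)
  also have "norm \<dots> \<ge> amp q"
    unfolding amp_def
  proof (rule coordinate_sum_ge[OF q(1,2) L_pos])
    have "\<bar>\<beta>\<bar> = \<bar>real q * (real T ^ (n + 2) * y) - of_int a\<bar> / real q"
      using q by (simp add: \<beta>_def abs_div_pos[symmetric] field_simps)
    also have "\<dots> \<le> (1 / real T) / real q"
      using a by (intro divide_right_mono) auto
    finally have "real L * \<bar>\<beta>\<bar> \<le> real L * (1 / real T / real q)"
      by (intro mult_left_mono) auto
    also have "\<dots> = real T ^ k / (real K * real q)"
      using T0 by (simp add: L_real n)
    \<comment> \<open>This fixes \<open>K = 64 * 4 ^ k\<close>: the lower bound on \<open>q\<close>
      gives \<open>T ^ k / q <= 2 * 4 ^ k\<close>.\<close>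
    also have "\<dots> \<le> 1 / 32"
      using q K by (simp add: field_simps)
    finally show "real L * \<bar>\<beta>\<bar> \<le> 1 / 32" .
    show "d \<ge> 0" using t0 D0 by (simp add: d_def)
    have "d * real L = \<theta> / real K"
    proof -
      have "d * real L = 4 * pi * (real T ^ (n + 2) * real T ^ n) / real K * (\<theta> / (4 * pi * real T ^ (2 * n + 2)))"
      proof -
        have "2 * (2 * pi * a) * (\<theta> / b) * (c / \<kappa>) = 4 * pi * (a * c) / \<kappa> * (\<theta> / b)" for a b c \<kappa> :: real
          by (simp add: mult_ac)
        then show ?thesis unfolding d_def D_def L_real t .
      qed
      also have "real T ^ (n + 2) * real T ^ n = real T ^ (2 * n + 2)"
        by (simp add: power_add[symmetric] mult_2)
      also have "4 * pi * real T ^ (2 * n + 2) / real K * (\<theta> / (4 * pi * real T ^ (2 * n + 2))) = \<theta> / real K"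
      proof -
        have "4 * pi * P / real K * (\<theta> / (4 * pi * P)) = \<theta> / real K" if "P > 0" for P
          using that by simp
        then show ?thesis using T0 by (simp only: zero_less_power)
      qed
      finally show ?thesis .
    qed
    also have "\<dots> \<le> 1 / real K"
    proof -
      have "\<theta> \<le> 1" using \<theta>(2) K_ge by (rule_tac order_trans) auto
      then show ?thesis by (intro divide_right_mono) auto
    qed
    finally have 1: "d * real L \<le> 1 / real K" .
    have "t \<le> \<theta>"
    proof -
      have "1 * 1 \<le> (4 * pi) * real T ^ (2 * n + 2)"
        by (rule mult_mono[OF _ T_power_ge_1]) (use pi_ge_two in auto)
      then show ?thesis unfolding t using \<theta>0 divide_left_mono[of 1 "4 * pi * real T ^ (2 * n + 2)" \<theta>] by simp
    qed
    moreover have "1 / real K \<le> 1 / 256" using K_ge by (intro divide_left_mono) auto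
    ultimately show "\<bar>y\<bar> + d * real L + \<bar>t\<bar> \<le> 1 / 16"
      using 1 y t0 \<theta>(2) by linarith
  qed
  finally show ?thesis .
qed

text \<open>The velocity \<open>2 * v\<close> carries the centre to exactly \<open>\<theta>\<close>.
  In units of the width, \<open>y\<close> is within \<open>1 / K\<close> of it, and the rescaled
  time is \<open>\<theta> / (4 * pi)\<close>, too short for dispersion, so \<open>gauss_osc\<close>
  is still close to 1.\<close>

lemma longitudinal_ge:
  assumes \<theta>: "0 \<le> \<theta>" "\<theta> \<le> 1 / real K"
    and t: "t = \<theta> / (4 * pi * real T ^ (2 * n + 2))"
    and y: "\<theta> \<le> y" "y < \<theta> + 1 / (real K * real T ^ (n + 1))"
  shows "1 / 2 \<le> norm (\<Sum>v\<in>V i0. exp (\<i> * complex_of_real (v * y + v\<^sup>2 * t)) * gauss_osc (\<sigma> i0 * (y + 2 * v * t)) ((\<sigma> i0)\<^sup>2 * t))"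
proof -
  define v where "v = - (2 * pi * real T ^ (2 * n + 2))"
  have T0: "real T > 0" and K0: "real K > 0" using T_pos K_pos by auto
  have "2 * v * t = - \<theta>" using T0 by (simp add: v_def t)
  then have "\<sigma> i0 * (y + 2 * v * t) = real T ^ (n + 1) * (y - \<theta>)"
    by (simp add: \<sigma>_def)
  moreover have "real T ^ (n + 1) * (y - \<theta>) \<le> real T ^ (n + 1) * (1 / (real K * real T ^ (n + 1)))"
    using y by (intro mult_left_mono) auto
  moreover have "real T ^ (n + 1) * (1 / (real K * real T ^ (n + 1))) = 1 / real K"
    using T0 by simp
  moreover have "0 \<le> real T ^ (n + 1) * (y - \<theta>)" using y by simp
  ultimately have 1: "\<bar>\<sigma> i0 * (y + 2 * v * t)\<bar> \<le> 1 / real K" by linarith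
  have "(\<sigma> i0)\<^sup>2 = real T ^ (2 * n + 2)"
    by (simp add: \<sigma>_def power_mult[symmetric] power_add[symmetric] algebra_simps)
  then have "(\<sigma> i0)\<^sup>2 * t = \<theta> / (4 * pi)" using T0 by (simp add: t)
  also have "\<dots> \<le> \<theta> / 1" using \<theta> pi_ge_two by (intro divide_left_mono) auto
  finally have 2: "\<bar>(\<sigma> i0)\<^sup>2 * t\<bar> \<le> 1 / real K" using \<theta> T0 by (simp add: t)
  have "1 / real K \<le> 1 / 256" using K_ge by (intro divide_left_mono) auto
  then have "norm (gauss_osc (\<sigma> i0 * (y + 2 * v * t)) ((\<sigma> i0)\<^sup>2 * t) - 1) \<le> 1 / 2"
    using 1 2 gauss_osc_near_1[of "\<sigma> i0 * (y + 2 * v * t)" "(\<sigma> i0)\<^sup>2 * t"] by linarith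
  then have "1 / 2 \<le> norm (gauss_osc (\<sigma> i0 * (y + 2 * v * t)) ((\<sigma> i0)\<^sup>2 * t))"
    using norm_triangle_ineq2[of 1 "gauss_osc (\<sigma> i0 * (y + 2 * v * t)) ((\<sigma> i0)\<^sup>2 * t)"]
    by (simp add: norm_minus_commute)
  then show ?thesis
    unfolding V_def v_def[symmetric] by (simp add: norm_mult del: of_real_add of_real_mult)
qed

lemma schroedinger_wave_ge:
  assumes q: "q > 0" "coprime p (4 * q)" "real T ^ k \<le> 2 * 4 ^ k * real q"
    and \<theta>: "\<theta> = real p / (2 * real q * (real T)\<^sup>2)" "\<theta> \<le> 1 / real K"
    and t: "t = \<theta> / (4 * pi * real T ^ (2 * n + 2))"
    and x0: "\<theta> \<le> x $ i0" "x $ i0 < \<theta> + 1 / (real K * real T ^ (n + 1))"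
    and x: "\<And>j. j \<noteq> i0 \<Longrightarrow> 0 \<le> x $ j" "\<And>j. j \<noteq> i0 \<Longrightarrow> x $ j < 1 / real K"
    and good: "good q x"
    and H: "0 \<le> H" "H \<le> amp q"
  shows "1 / 2 * H ^ k \<le> cmod (schroedinger t (wave \<sigma> V) x)"
proof -
  let ?S = "\<lambda>i. norm (\<Sum>v\<in>V i. exp (\<i> * complex_of_real (v * x $ i + v\<^sup>2 * t)) * gauss_osc (\<sigma> i * (x $ i + 2 * v * t)) ((\<sigma> i)\<^sup>2 * t))"
  have "cmod (schroedinger t (wave \<sigma> V) x) = (\<Prod>i\<in>UNIV. ?S i)"
    unfolding schroedinger_wave[OF \<sigma>_pos finite_V] by (rule prod_norm[symmetric])
  also have "\<dots> = ?S i0 * (\<Prod>i\<in>UNIV - {i0}. ?S i)"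
    by (subst prod.remove[of _ i0]) auto
  also have "\<dots> \<ge> 1 / 2 * (\<Prod>i\<in>UNIV - {i0}. H)"
  proof (intro mult_mono prod_mono conjI)
    show "1 / 2 \<le> ?S i0"
      using \<theta> by (intro longitudinal_ge[OF _ \<theta>(2) t x0]) simp
    fix j assume "j \<in> UNIV - {i0}"
    then have j: "j \<noteq> i0" by simp
    then obtain a :: int where "\<bar>real q * (real T ^ (n + 2) * x $ j) - of_int a\<bar> < 1 / real T"
      using good unfolding good_def by blast
    then have "amp q \<le> ?S j"
      using x[OF j] by (intro transversal_sum_ge[OF q \<theta> t _ _ _ j]) auto
    then show "H \<le> ?S j" using H by linarith
  qed (use H in \<open>auto intro: prod_nonneg\<close>)
  also have "(\<Prod>i\<in>UNIV - {i0}. H) = H ^ k"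
    using card n by (simp add: card_Diff_singleton)
  finally show ?thesis .
qed

section \<open>The set where the solution is large, and its measure\<close>

definition \<tau> :: real where
  "\<tau> = 1 / (real K * real T ^ (n + 1))"

text \<open>
  Taking the least good denominator makes the slabs disjoint. All slabs have the same longitudinal
  thickness \<open>\<tau>\<close>, so the measure of the set where the solution is large follows from
  translation invariance, without a Fubini argument.
\<close>
definition slab :: "nat \<Rightarrow> (real^'n) set" where
  "slab q = {x. 0 \<le> x $ i0 \<and> x $ i0 < \<tau> \<and> (\<forall>j. j \<noteq> i0 \<longrightarrow> 0 \<le> x $ j \<and> x $ j < 1 / real K) \<and>
     good q x \<and> (\<forall>q'\<in>{1..<q}. \<not> good q' x)}"

lemma \<tau>_pos: "\<tau> > 0"
  using T_pos K_pos by (simp add: \<tau>_def)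

lemma good_measurable [measurable]: "Measurable.pred borel (good q)"
  unfolding good_def[abs_def] by measurable

lemma slab_measurable [measurable]: "slab q \<in> sets borel"
  unfolding slab_def by measurable

lemma dirichlet: "\<exists>q\<in>{1..T ^ k}. good q x"
proof -
  have "card (UNIV - {i0}) = k" using card n by (simp add: card_Diff_singleton)
  then obtain h where h: "bij_betw h (UNIV - {i0}) {0..<k}"
    using ex_bij_betw_finite_nat[of "UNIV - {i0}"] by auto
  obtain q a where qa: "0 < q" "q \<le> int (T ^ k)"
    "\<And>i. i < k \<Longrightarrow> \<bar>of_int q * (real T ^ (n + 2) * x $ (inv_into (UNIV - {i0}) h i)) - of_int (a i)\<bar> < 1 / real T"
    using Dirichlet_approx_simult[OF T_pos, of k "\<lambda>i. real T ^ (n + 2) * x $ (inv_into (UNIV - {i0}) h i)"] by metis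
  have "good (nat q) x"
    unfolding good_def
  proof (intro allI impI)
    fix j assume j: "j \<noteq> i0"
    then have "h j < k" using bij_betwE[OF h] by auto
    moreover have "inv_into (UNIV - {i0}) h (h j) = j"
      using bij_betw_inv_into_left[OF h] j by auto
    ultimately have "\<bar>real (nat q) * (real T ^ (n + 2) * x $ j) - of_int (a (h j))\<bar> < 1 / real T"
      using qa(3)[of "h j"] qa(1) by simp
    then show "\<exists>a::int. \<bar>real (nat q) * (real T ^ (n + 2) * x $ j) - of_int a\<bar> < 1 / real T" by blast
  qed
  moreover have "nat q \<in> {1..T ^ k}" using qa(1,2) by (auto simp: nat_le_iff)
  ultimately show ?thesis by blast
qed

text \<open>With \<open>c = q * T ^ (n + 2)\<close>, the interval contains \<open>A = c / K\<close>
  spacings of \<open>1 / c\<close>; divisibility of \<open>T\<close> by \<open>K\<close> makes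
  \<open>A\<close> an integer. At most \<open>A + 1 <= 2 * A\<close> intervals of length
  \<open>2 / (c * T)\<close> suffice, and \<open>c\<close> cancels, so the bound is the same for
  every \<open>q\<close>.\<close>

lemma emeasure_approx_le:
  assumes q: "q > 0"
  shows "emeasure lborel {y. 0 \<le> y \<and> y < 1 / real K \<and> (\<exists>a::int. \<bar>real q * (real T ^ (n + 2) * y) - of_int a\<bar> < 1 / real T)}
    \<le> ennreal (4 / (real K * real T))"
proof -
  define A where "A = q * u * T ^ (n + 1)"
  define c where "c = real q * real T ^ (n + 2)"
  have T0: "real T > 0" and K0: "real K > 0" using T_pos K_pos by auto
  have c0: "c > 0" using T0 q by (simp add: c_def)
  have A: "real A = c / real K"
    unfolding A_def c_def using K0 by (simp add: T field_simps)
  have A1: "A \<ge> 1" using q u T_pos by (simp add: A_def)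
  let ?I = "\<lambda>a. {(real a - 1 / real T) / c <..< (real a + 1 / real T) / c}"
  have "{y. 0 \<le> y \<and> y < 1 / real K \<and> (\<exists>a::int. \<bar>real q * (real T ^ (n + 2) * y) - of_int a\<bar> < 1 / real T)} \<subseteq> (\<Union>a\<in>{..A}. ?I a)"
  proof
    fix y assume "y \<in> {y. 0 \<le> y \<and> y < 1 / real K \<and> (\<exists>a::int. \<bar>real q * (real T ^ (n + 2) * y) - of_int a\<bar> < 1 / real T)}"
    then obtain a :: int where y: "0 \<le> y" "y < 1 / real K" and a: "\<bar>c * y - of_int a\<bar> < 1 / real T"
      by (auto simp: c_def mult.assoc)
    have T1: "1 / real T \<le> 1" using T_pos by simp
    have "0 \<le> c * y" using y c0 by simp
    then have a0: "a \<ge> 0" using a T1 by linarith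
    have "c * y < c * (1 / real K)" using y c0 by (intro mult_strict_left_mono)
    then have "of_int a < real A + 1" using a T1 A by simp
    then have "nat a \<le> A" using a0 by linarith
    moreover have "y \<in> ?I (nat a)" using a a0 c0 by (auto simp: field_simps abs_less_iff)
    ultimately show "y \<in> (\<Union>a\<in>{..A}. ?I a)" by blast
  qed
  then have "emeasure lborel {y. 0 \<le> y \<and> y < 1 / real K \<and> (\<exists>a::int. \<bar>real q * (real T ^ (n + 2) * y) - of_int a\<bar> < 1 / real T)}
     \<le> emeasure lborel (\<Union>a\<in>{..A}. ?I a)"
    by (intro emeasure_mono) auto
  also have "\<dots> \<le> (\<Sum>a\<in>{..A}. emeasure lborel (?I a))"
    by (intro emeasure_subadditive_finite) auto
  also have "\<dots> = (\<Sum>a\<in>{..A}. ennreal (2 / (c * real T)))"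
  proof (intro sum.cong refl)
    fix a
    have "(real a - 1 / real T) / c \<le> (real a + 1 / real T) / c" using c0 T0 by (intro divide_right_mono) auto
    moreover have "(real a + 1 / real T) / c - (real a - 1 / real T) / c = 2 / (c * real T)"
      using c0 T0 by (simp add: field_simps)
    ultimately show "emeasure lborel (?I a) = ennreal (2 / (c * real T))" by simp
  qed
  also have "\<dots> = ennreal (real (A + 1) * (2 / (c * real T)))"
    unfolding sum_constant ennreal_of_nat_eq_real_of_nat card_atMost
    using c0 T0 by (subst ennreal_mult[symmetric]) auto
  also have "\<dots> \<le> ennreal (4 / (real K * real T))"
  proof (intro ennreal_leI)
    have "real (A + 1) * (2 / (c * real T)) \<le> (2 * real A) * (2 / (c * real T))"
      using A1 c0 T0 by (intro mult_right_mono) auto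
    also have "\<dots> = 4 / (real K * real T)"
      unfolding A using c0 by simp
    finally show "real (A + 1) * (2 / (c * real T)) \<le> 4 / (real K * real T)" .
  qed
  finally show ?thesis .
qed

lemma prod_fixed_coordinate:
  fixes a b :: ennreal
  shows "(\<Prod>i\<in>(UNIV::'n set). if i = i0 then a else b) = a * b ^ k"
proof -
  have "(\<Prod>i\<in>(UNIV::'n set). if i = i0 then a else b) = a * (\<Prod>i\<in>UNIV - {i0}. if i = i0 then a else b)"
    by (subst prod.remove[of _ i0]) auto
  also have "(\<Prod>i\<in>UNIV - {i0}. if i = i0 then a else b) = (\<Prod>i\<in>UNIV - {i0}. b)"
    by (intro prod.cong) auto
  also have "\<dots> = b ^ k" using card n by (simp add: card_Diff_singleton)
  finally show ?thesis .
qed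

lemma emeasure_slab_le:
  assumes "q > 0"
  shows "emeasure lborel (slab q) \<le> ennreal (\<tau> * (4 / (real K * real T)) ^ k)"
proof -
  let ?S = "{y. 0 \<le> y \<and> y < 1 / real K \<and> (\<exists>a::int. \<bar>real q * (real T ^ (n + 2) * y) - of_int a\<bar> < 1 / real T)}"
  define S where "S i = (if i = i0 then {0..<\<tau>} else ?S)" for i
  have [measurable]: "S i \<in> sets borel" for i
    unfolding S_def by (cases "i = i0") (simp_all, measurable)
  have "slab q \<subseteq> {x. \<forall>i. x $ i \<in> S i}"
    by (auto simp: slab_def S_def good_def)
  then have "emeasure lborel (slab q) \<le> emeasure lborel {x::real^'n. \<forall>i. x $ i \<in> S i}"
    by (intro emeasure_mono) measurable
  also have "\<dots> = (\<Prod>i\<in>UNIV. emeasure lborel (S i))"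
    by (rule emeasure_vec_box) measurable
  also have "\<dots> \<le> (\<Prod>i\<in>(UNIV::'n set). if i = i0 then ennreal \<tau> else ennreal (4 / (real K * real T)))"
    using emeasure_approx_le[OF assms] \<tau>_pos by (intro prod_mono_ennreal) (auto simp: S_def)
  also have "\<dots> = ennreal (\<tau> * (4 / (real K * real T)) ^ k)"
    unfolding prod_fixed_coordinate using \<tau>_pos by (simp add: ennreal_mult ennreal_power)
  finally show ?thesis .
qed

definition large :: "nat set" where
  "large = {q \<in> {1..T ^ k}. real T ^ k \<le> 2 * 4 ^ k * real q}"

text \<open>By Dirichlet's theorem the slabs cover the whole box, of measure
  \<open>\<tau> / K ^ k\<close>. At most \<open>T ^ k / (2 * 4 ^ k)\<close> denominators fall
  outside \<open>large\<close>, and each slab has measure at most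
  \<open>\<tau> * (4 / (K * T)) ^ k\<close>; the factor \<open>2 * 4 ^ k\<close> in
  \<open>large\<close> is what makes their total at most half the box.\<close>

lemma sum_emeasure_slab_ge:
  "ennreal (\<tau> / real K ^ k / 2) \<le> (\<Sum>q\<in>large. emeasure lborel (slab q))"
proof -
  define x where "x = \<tau> / real K ^ k / 2"
  have T0: "real T > 0" and K0: "real K > 0" using T_pos K_pos by auto
  have x0: "x \<ge> 0" using \<tau>_pos by (simp add: x_def)
  let ?small = "{q \<in> {1..T ^ k}. \<not> real T ^ k \<le> 2 * 4 ^ k * real q}"
  define S where "S i = (if i = i0 then {0..<\<tau>} else {0..<1 / real K})" for i
  have "ennreal (x + x) = ennreal (\<tau> * (1 / real K) ^ k)"
    by (simp add: x_def power_one_over field_simps)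
  also have "\<dots> = (\<Prod>i\<in>(UNIV::'n set). if i = i0 then ennreal \<tau> else ennreal (1 / real K))"
    unfolding prod_fixed_coordinate using \<tau>_pos by (simp add: ennreal_mult ennreal_power)
  also have "\<dots> = (\<Prod>i\<in>(UNIV::'n set). emeasure lborel (S i))"
    using \<tau>_pos by (intro prod.cong) (auto simp: S_def)
  also have "\<dots> = emeasure lborel {x::real^'n. \<forall>i. x $ i \<in> S i}"
    by (rule emeasure_vec_box[symmetric]) (auto simp: S_def)
  also have "\<dots> \<le> emeasure lborel (\<Union>q\<in>{1..T ^ k}. slab q)"
  proof (intro emeasure_mono)
    show "{x. \<forall>i. x $ i \<in> S i} \<subseteq> (\<Union>q\<in>{1..T ^ k}. slab q)"
    proof
      fix x :: "real^'n" assume x: "x \<in> {x. \<forall>i. x $ i \<in> S i}"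
      define q where "q = (LEAST q. q \<ge> 1 \<and> good q x)"
      obtain q' where q': "q' \<in> {1..T ^ k}" "good q' x" using dirichlet by blast
      then have "q \<ge> 1 \<and> good q x" unfolding q_def by (intro LeastI[of "\<lambda>q. q \<ge> 1 \<and> good q x" q']) simp
      moreover have "q \<le> q'" unfolding q_def using q' by (intro Least_le[of "\<lambda>q. q \<ge> 1 \<and> good q x"]) simp
      moreover have "\<not> good q'' x" if "q'' \<in> {1..<q}" for q''
        using not_less_Least[of q'' "\<lambda>q. q \<ge> 1 \<and> good q x"] that unfolding q_def by auto
      moreover have "x $ i \<in> S i" for i using x by auto
      note this[unfolded S_def]
      ultimately have "x \<in> slab q" "q \<in> {1..T ^ k}"
        using q' unfolding slab_def by (force split: if_splits)+
      then show "x \<in> (\<Union>q\<in>{1..T ^ k}. slab q)" by blast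
    qed
  qed measurable
  also have "\<dots> \<le> (\<Sum>q\<in>{1..T ^ k}. emeasure lborel (slab q))"
    by (intro emeasure_subadditive_finite) auto
  also have "\<dots> = (\<Sum>q\<in>?small. emeasure lborel (slab q)) + (\<Sum>q\<in>large. emeasure lborel (slab q))"
    unfolding large_def by (subst sum.union_disjoint[symmetric]) (auto intro!: sum.cong)
  also have "(\<Sum>q\<in>?small. emeasure lborel (slab q)) \<le> ennreal x"
  proof -
    have "(\<Sum>q\<in>?small. emeasure lborel (slab q)) \<le> (\<Sum>q\<in>?small. ennreal (\<tau> * (4 / (real K * real T)) ^ k))"
      by (intro sum_mono emeasure_slab_le) auto
    also have "\<dots> = ennreal (real (card ?small) * (\<tau> * (4 / (real K * real T)) ^ k))"
      using \<tau>_pos by (simp add: ennreal_of_nat_eq_real_of_nat ennreal_mult[symmetric])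
    also have "\<dots> \<le> ennreal x"
    proof (intro ennreal_leI)
      have "real (card ?small) \<le> real T ^ k / (2 * 4 ^ k)"
      proof (cases "?small = {}")
        case False
        define m where "m = Max ?small"
        have fin: "finite ?small" by simp
        have m: "m \<in> ?small" unfolding m_def by (rule Max_in[OF fin False])
        have "?small \<subseteq> {1..m}" unfolding m_def using Max_ge[OF fin] by force
        then have "card ?small \<le> m" using card_mono[of "{1..m}" ?small] by simp
        then have "real (card ?small) \<le> real m" by simp
        also have "\<dots> \<le> real T ^ k / (2 * 4 ^ k)" using m by (simp add: field_simps)
        finally show ?thesis .
      next
        case True
        show ?thesis unfolding True by simp
      qed
      then have "real (card ?small) * (\<tau> * (4 / (real K * real T)) ^ k) \<le> real T ^ k / (2 * 4 ^ k) * (\<tau> * (4 / (real K * real T)) ^ k)"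
        using \<tau>_pos by (intro mult_right_mono) auto
      also have "\<dots> = x" unfolding x_def using T0 by (simp add: power_divide power_mult_distrib)
      finally show "real (card ?small) * (\<tau> * (4 / (real K * real T)) ^ k) \<le> x" .
    qed
    finally show ?thesis .
  qed
  finally have "ennreal (x + x) \<le> ennreal x + (\<Sum>q\<in>large. emeasure lborel (slab q))"
    by (simp add: add_right_mono)
  then have "ennreal x + ennreal x \<le> ennreal x + (\<Sum>q\<in>large. emeasure lborel (slab q))"
    by (simp only: ennreal_plus[OF x0 x0])
  then show ?thesis
    unfolding x_def[symmetric] by (simp add: ennreal_add_left_cancel_le)
qed

text \<open>The longitudinal displacement at time \<open>p / (8 pi q T ^ (2 n + 4))\<close>.\<close>

definition shift :: "nat \<Rightarrow> nat \<Rightarrow> real" where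
  "shift q p = real p / (2 * real q * (real T)\<^sup>2)"

definition units :: "nat \<Rightarrow> nat set" where
  "units q = {p. p < M * (4 * q) \<and> coprime p (4 * q)}"

definition piece :: "nat \<times> nat \<Rightarrow> (real^'n) set" where
  "piece = (\<lambda>(q, p). {x. x - axis i0 (shift q p) \<in> slab q})"

lemma finite_units: "finite (units q)"
  by (rule finite_subset[of _ "{..<M * (4 * q)}"]) (auto simp: units_def)

lemma finite_large: "finite large"
  by (simp add: large_def)

text \<open>The relation \<open>2 * K * M = T^2\<close> is chosen for this:
  \<open>p <= 4 * q * M\<close> gives a displacement of at most \<open>2 * M / T^2\<close>.\<close>

lemma shift_le:
  assumes "q > 0" "p \<in> units q"
  shows "shift q p \<le> 1 / real K"
proof -
  have "p \<le> M * (4 * q)" using assms by (simp add: units_def)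
  then have "real p \<le> real (M * (4 * q))" by (simp only: of_nat_le_iff)
  then have "shift q p \<le> real (M * (4 * q)) / (2 * real q * (real T)\<^sup>2)"
    unfolding shift_def by (intro divide_right_mono) auto
  also have "\<dots> = 2 * real M / (real T)\<^sup>2" using assms by simp
  also have "(real T)\<^sup>2 = 2 * real K * real M" using arg_cong[OF M, of real] by simp
  also have "2 * real M / (2 * real K * real M) \<le> 1 / real K"
    by (cases "M = 0") auto
  finally show ?thesis .
qed

lemma pieceD:
  assumes "x \<in> piece (q, p)"
  shows "shift q p \<le> x $ i0" "x $ i0 < shift q p + \<tau>"
    "\<And>j. j \<noteq> i0 \<Longrightarrow> 0 \<le> x $ j" "\<And>j. j \<noteq> i0 \<Longrightarrow> x $ j < 1 / real K"
    "good q x" "\<And>q'. q' \<in> {1..<q} \<Longrightarrow> \<not> good q' x"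
proof -
  let ?y = "x - axis i0 (shift q p)"
  have y: "?y $ i0 = x $ i0 - shift q p" "\<And>j. j \<noteq> i0 \<Longrightarrow> ?y $ j = x $ j"
    by (auto simp: axis_def)
  have g: "good q' ?y \<longleftrightarrow> good q' x" for q'
    unfolding good_def using y(2) by auto
  have *: "?y \<in> slab q" using assms by (simp add: piece_def)
  then show "shift q p \<le> x $ i0" "x $ i0 < shift q p + \<tau>"
    unfolding slab_def using y(1) by auto
  show "good q x" "\<And>q'. q' \<in> {1..<q} \<Longrightarrow> \<not> good q' x"
  proof -
    have "good q ?y" "\<And>q'. q' \<in> {1..<q} \<Longrightarrow> \<not> good q' ?y" using * unfolding slab_def by blast+
    then show "good q x" "\<And>q'. q' \<in> {1..<q} \<Longrightarrow> \<not> good q' x" unfolding g by blast+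
  qed
  show "0 \<le> x $ j" "x $ j < 1 / real K" if "j \<noteq> i0" for j
    using * y(2)[OF that] that unfolding slab_def by auto
qed

lemma piece_measurable [measurable]: "piece z \<in> sets borel"
proof -
  obtain q p where z: "z = (q, p)" by (cases z)
  show ?thesis unfolding z piece_def prod.case by measurable
qed

text \<open>Two denominators cannot both be the least good one for the same point. For a common
  \<open>q\<close>, consecutive displacements differ by \<open>1 / (2 * q * T^2)\<close>, which is
  at least \<open>\<tau>\<close> because \<open>q <= T ^ k\<close> and
  \<open>K >= 2\<close>.\<close>

lemma disjoint_pieces: "disjoint_family_on piece (Sigma large units)"
proof (unfold disjoint_family_on_def, intro ballI impI)
  fix z z' assume zz: "z \<in> Sigma large units" "z' \<in> Sigma large units" "z \<noteq> z'"
  obtain q p q' p' where z: "z = (q, p)" "z' = (q', p')" by (cases z, cases z')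
  have q: "q \<ge> 1" "q' \<ge> 1" "q \<le> T ^ k" using zz z by (auto simp: large_def)
  show "piece z \<inter> piece z' = {}"
  proof (rule ccontr)
    assume "piece z \<inter> piece z' \<noteq> {}"
    then obtain x where x: "x \<in> piece (q, p)" "x \<in> piece (q', p')" using z by auto
    have "q = q'"
      using pieceD(5,6)[OF x(1)] pieceD(5,6)[OF x(2)] q by (metis atLeastLessThan_iff linorder_neqE_nat)
    then have "p \<noteq> p'" using zz z by auto
    have step: False if "p1 < p2" "x \<in> piece (q, p1)" "x \<in> piece (q, p2)" for p1 p2
    proof -
      have "shift q p1 + 1 / (2 * real q * (real T)\<^sup>2) = (real p1 + 1) / (2 * real q * (real T)\<^sup>2)"
        by (simp add: shift_def add_divide_distrib)
      also have "\<dots> \<le> shift q p2"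
        unfolding shift_def using that by (intro divide_right_mono) auto
      finally have "1 / (2 * real q * (real T)\<^sup>2) < \<tau>"
        using pieceD(2)[OF that(2)] pieceD(1)[OF that(3)] by linarith
      moreover have "\<tau> \<le> 1 / (2 * real q * (real T)\<^sup>2)"
        unfolding \<tau>_def
      proof (intro divide_left_mono)
        have "real q \<le> real T ^ k" using q by (metis of_nat_le_iff of_nat_power)
        then have "2 * real q * (real T)\<^sup>2 \<le> real K * real T ^ k * (real T)\<^sup>2"
          using K_ge by (intro mult_right_mono mult_mono) auto
        also have "\<dots> = real K * real T ^ (n + 1)" by (simp add: n power2_eq_square)
        finally show "2 * real q * (real T)\<^sup>2 \<le> real K * real T ^ (n + 1)" .
      qed (use q T_pos K_pos in auto)
      ultimately show False by linarith
    qed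
    show False
      using step[of p p'] step[of p' p] x \<open>q = q'\<close> \<open>p \<noteq> p'\<close> by (metis linorder_neqE_nat)
  qed
qed

lemma piece_subset_ball:
  assumes "q \<in> large" "p \<in> units q"
  shows "piece (q, p) \<subseteq> ball 0 1"
proof
  fix x assume x: "x \<in> piece (q, p)"
  have "q > 0" using assms by (auto simp: large_def)
  have "real K * 1 \<le> real K * real T ^ (n + 1)"
    using T_pos one_le_power[of "real T" "n + 1"] by (intro mult_left_mono) auto
  then have t: "\<tau> \<le> 1 / real K" unfolding \<tau>_def using K_pos by (intro divide_left_mono) auto
  have "\<bar>x $ i\<bar> \<le> 2 / real K" for i
  proof (cases "i = i0")
    case True
    have "0 \<le> shift q p" by (simp add: shift_def)
    then show ?thesis using True pieceD(1,2)[OF x] shift_le[OF \<open>q > 0\<close> assms(2)] t by simp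
  next
    case False
    have "1 / real K \<le> 2 / real K" by (intro divide_right_mono) auto
    then show ?thesis using pieceD(3,4)[OF x False] by linarith
  qed
  then have "norm x \<le> (\<Sum>i\<in>(UNIV::'n set). 2 / real K)"
    by (intro order_trans[OF norm_le_l1_cart] sum_mono)
  also have "\<dots> = 2 * real n / real K" using card by simp
  also have "\<dots> < 1"
  proof -
    define w where "w = (4::nat) ^ k"
    have "k < w" unfolding w_def by (rule power_gt_expt) simp
    then have "2 * n < K" unfolding K n w_def[symmetric] by simp
    then have "real (2 * n) < real K" by (simp only: of_nat_less_iff)
    then show ?thesis using K_pos by simp
  qed
  finally show "x \<in> ball 0 1" by (simp add: dist_norm)
qed

text \<open>Each slab occurs in \<open>M * totient (4 * q)\<close> disjoint translates of equal
  measure, so their union has at least \<open>M * \<phi>\<close> times the total slab measure. At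
  each of its points the time belonging to \<open>(q, p)\<close> is a competitor in the
  supremum.\<close>

lemma max_L1_ball_ge:
  assumes H: "0 \<le> H" "\<And>q. q \<in> large \<Longrightarrow> H \<le> amp q"
    and \<phi>: "\<And>q. q \<in> large \<Longrightarrow> \<phi> \<le> real (totient (4 * q))" "0 \<le> \<phi>"
  shows "max_L1_ball (wave \<sigma> V) \<ge> ennreal (1 / 2 * H ^ k * (real M * \<phi> * (\<tau> / real K ^ k / 2)))"
proof -
  let ?G = "\<Union>z\<in>Sigma large units. piece z"
  have fin: "finite (Sigma large units)"
    by (intro finite_SigmaI finite_large finite_units)
  have ge: "ennreal (1 / 2 * H ^ k) * indicator ?G x \<le>
     (SUP t\<in>{0<..<1}. ennreal (cmod (schroedinger t (wave \<sigma> V) x))) * indicator (ball 0 1) x" for x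
  proof (cases "x \<in> ?G")
    case True
    then obtain q p where qp: "q \<in> large" "p \<in> units q" and x: "x \<in> piece (q, p)" by auto
    define \<theta> where "\<theta> = shift q p"
    define t where "t = \<theta> / (4 * pi * real T ^ (2 * n + 2))"
    have q: "q > 0" "real T ^ k \<le> 2 * 4 ^ k * real q" "coprime p (4 * q)"
      using qp by (auto simp: large_def units_def)
    \<comment> \<open>The numerator 0 is coprime only to 1. It must be excluded because the supremum
      runs over strictly positive times.\<close>
    have "4 * q \<noteq> 1" by presburger
    then have "p > 0" using q(3) by (cases p) auto
    then have \<theta>0: "\<theta> > 0" using q T_pos by (simp add: \<theta>_def shift_def)
    have \<theta>1: "\<theta> \<le> 1 / real K" unfolding \<theta>_def by (rule shift_le[OF q(1) qp(2)])
    also have "\<dots> \<le> 1 / 256" using K_ge by (intro divide_left_mono) auto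
    finally have "\<theta> < 1" by simp
    moreover have "t \<le> \<theta>"
    proof -
      have "1 * 1 \<le> (4 * pi) * real T ^ (2 * n + 2)"
        by (rule mult_mono[OF _ T_power_ge_1]) (use pi_ge_two in auto)
      then show ?thesis unfolding t_def using \<theta>0 divide_left_mono[of 1 "4 * pi * real T ^ (2 * n + 2)" \<theta>] by simp
    qed
    moreover have "t > 0" using \<theta>0 T_pos by (simp add: t_def)
    ultimately have t: "t \<in> {0<..<1}" by simp
    have "1 / 2 * H ^ k \<le> cmod (schroedinger t (wave \<sigma> V) x)"
      by (rule schroedinger_wave_ge[OF q(1,3,2) _ \<theta>1 t_def _ _ _ _ pieceD(5)[OF x] H(1) H(2)[OF qp(1)]])
        (use pieceD[OF x] in \<open>auto simp: \<theta>_def shift_def \<tau>_def\<close>)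
    then have "ennreal (1 / 2 * H ^ k) \<le> (SUP t\<in>{0<..<1}. ennreal (cmod (schroedinger t (wave \<sigma> V) x)))"
      by (intro SUP_upper2[OF t] ennreal_leI)
    moreover have "x \<in> ball 0 1" using piece_subset_ball[OF qp] x by blast
    ultimately show ?thesis using True by (simp del: Union_iff UN_iff)
  qed (simp add: indicator_def)
  have em: "emeasure lborel (piece (q, p)) = emeasure lborel (slab q)" for q p
    unfolding piece_def by (simp add: emeasure_lborel_translate)
  have "ennreal (real M * \<phi> * (\<tau> / real K ^ k / 2)) = ennreal (real M * \<phi>) * ennreal (\<tau> / real K ^ k / 2)"
    using \<phi> \<tau>_pos by (intro ennreal_mult) auto
  also have "\<dots> \<le> ennreal (real M * \<phi>) * (\<Sum>q\<in>large. emeasure lborel (slab q))"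
    by (intro mult_left_mono sum_emeasure_slab_ge) auto
  also have "\<dots> = (\<Sum>q\<in>large. ennreal (real M * \<phi>) * emeasure lborel (slab q))"
    by (rule sum_distrib_left)
  also have "\<dots> \<le> (\<Sum>q\<in>large. \<Sum>p\<in>units q. emeasure lborel (piece (q, p)))"
  proof (intro sum_mono)
    fix q assume q: "q \<in> large"
    then have "4 * q > 1" by (auto simp: large_def)
    then have "card (units q) = M * totient (4 * q)"
      unfolding units_def by (rule card_coprime_lessThan)
    then have "real M * \<phi> \<le> real (card (units q))"
      using \<phi>(1)[OF q] by (simp add: mult_left_mono)
    then have "ennreal (real M * \<phi>) \<le> of_nat (card (units q))"
      unfolding ennreal_of_nat_eq_real_of_nat by (rule ennreal_leI)
    then show "ennreal (real M * \<phi>) * emeasure lborel (slab q) \<le> (\<Sum>p\<in>units q. emeasure lborel (piece (q, p)))"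
      unfolding em by (simp add: mult_right_mono)
  qed
  also have "\<dots> = (\<Sum>z\<in>Sigma large units. emeasure lborel (piece z))"
    by (subst sum.Sigma) (auto simp: finite_large finite_units)
  also have "\<dots> = emeasure lborel ?G"
    by (rule sum_emeasure) (auto simp: fin disjoint_pieces)
  finally have G: "ennreal (real M * \<phi> * (\<tau> / real K ^ k / 2)) \<le> emeasure lborel ?G" .
  have "?G \<in> sets borel" using fin by (intro sets.finite_UN) auto
  then have "ennreal (1 / 2 * H ^ k) * emeasure lborel ?G = (\<integral>\<^sup>+x. ennreal (1 / 2 * H ^ k) * indicator ?G x \<partial>lborel)"
    by (subst nn_integral_cmult_indicator) auto
  also have "\<dots> \<le> max_L1_ball (wave \<sigma> V)"
    unfolding max_L1_ball_def by (intro nn_integral_mono ge)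
  finally have "ennreal (1 / 2 * H ^ k) * emeasure lborel ?G \<le> max_L1_ball (wave \<sigma> V)" .
  from order_trans[OF mult_left_mono[OF G zero_le] this]
  have "ennreal (1 / 2 * H ^ k) * ennreal (real M * \<phi> * (\<tau> / real K ^ k / 2)) \<le> max_L1_ball (wave \<sigma> V)" .
  then show ?thesis
    using H \<phi> \<tau>_pos by (subst ennreal_mult) auto
qed

section \<open>The Sobolev norm of the datum and the comparison of powers\<close>

text \<open>Distinct transversal frequencies are at least \<open>D\<close> apart and
  \<open>D^2 / 8 >= L\<close>, so by \<open>exp x >= 1 + x\<close> each off-diagonal term is at most
  \<open>1 / L\<close>. There are at most \<open>L\<close> of them, and the diagonal term adds
  1.\<close>

lemma separated:
  assumes v: "v \<in> V i"
  shows "(\<Sum>w\<in>V i. exp (- (v - w)\<^sup>2 / (8 * (\<sigma> i)\<^sup>2))) \<le> 2"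
proof (cases "i = i0")
  case True
  then show ?thesis using v by (simp add: V_def)
next
  case False
  define D where "D = 2 * pi * real T ^ (n + 2)"
  have VD: "V i = (\<lambda>l. D * real l) ` {..<L}" using False by (simp add: V_def D_def)
  have card: "real (card (V i)) \<le> real L"
    unfolding VD using card_image_le[of "{..<L}" "\<lambda>l. D * real l"] by simp
  have LD: "real L \<le> D\<^sup>2 / 8"
  proof -
    have "real L \<le> real T ^ n * 1"
      using L_le by simp
    also have "\<dots> \<le> real T ^ (n + 2) * real T ^ (n + 2)"
      using T_pos by (intro mult_mono power_increasing T_power_ge_1) auto
    also have "\<dots> \<le> real T ^ (n + 2) * real T ^ (n + 2) * (pi * pi / 2)"
    proof -
      have "2 * 2 \<le> pi * pi" using pi_ge_two by (intro mult_mono) auto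
      then have "x * 1 \<le> x * (pi * pi / 2)" if "x \<ge> 0" for x
        using that by (intro mult_left_mono) auto
      then show ?thesis by simp
    qed
    also have "\<dots> = D\<^sup>2 / 8" by (simp add: D_def power2_eq_square)
    finally show ?thesis .
  qed
  have "exp (- (v - w)\<^sup>2 / 8) \<le> 1 / real L" if w: "w \<in> V i" "w \<noteq> v" for w
  proof -
    obtain l m where lm: "v = D * real l" "w = D * real m" using v w unfolding VD by auto
    then have "l \<noteq> m" using w by auto
    then have "1 \<le> \<bar>real l - real m\<bar>" by linarith
    then have "1 \<le> (real l - real m)\<^sup>2" using one_le_power[of "\<bar>real l - real m\<bar>" 2] by simp
    then have "D\<^sup>2 * 1 \<le> D\<^sup>2 * (real l - real m)\<^sup>2" by (intro mult_left_mono) auto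
    also have "\<dots> = (v - w)\<^sup>2" unfolding lm by (simp add: power_mult_distrib flip: right_diff_distrib)
    finally have "real L \<le> (v - w)\<^sup>2 / 8" using LD by simp
    also have "\<dots> \<le> exp ((v - w)\<^sup>2 / 8)" using exp_ge_add_one_self[of "(v - w)\<^sup>2 / 8"] by linarith
    finally show ?thesis
      using L_pos by (simp add: exp_minus field_simps)
  qed
  then have "(\<Sum>w\<in>V i - {v}. exp (- (v - w)\<^sup>2 / 8)) \<le> (\<Sum>w\<in>V i - {v}. 1 / real L)"
    by (intro sum_mono) auto
  also have "\<dots> \<le> real L * (1 / real L)"
    using card card_Diff1_le[of "V i" v] by (simp add: divide_right_mono)
  also have "\<dots> = 1" using L_pos by simp
  finally have "(\<Sum>w\<in>V i. exp (- (v - w)\<^sup>2 / 8)) \<le> 2"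
    using v finite_V[of i] by (simp add: sum.remove[of _ v])
  then show ?thesis using False by (simp add: \<sigma>_def)
qed

text \<open>The transversal frequencies stay below \<open>2 * pi * T ^ (n + 2) * T ^ n\<close>,
  which is the longitudinal frequency itself; one \<open>?R\<close> therefore serves every
  coordinate.\<close>

lemma sobolev_norm_le:
  assumes s: "0 < s" "s < 1"
  shows "sobolev_norm s (wave \<sigma> V) \<le> (2 * pi * real T ^ (2 * n + 2)) powr s *
    sqrt ((2 * pi) ^ n * (2 + 3 * real n) * 2 ^ n * (real L ^ k / real T ^ (n + 1)))"
proof -
  let ?R = "2 * pi * real T ^ (2 * n + 2)"
  have P: "real T ^ (2 * n + 2) \<le> ?R"
    using pi_ge_two mult_right_mono[of 1 "2 * pi" "real T ^ (2 * n + 2)"] by simp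
  have R1: "?R \<ge> 1" using P T_power_ge_1[of "2 * n + 2"] by linarith
  have cardV: "card (V i) = (if i = i0 then 1 else L)" for i
    using T_pos by (auto simp: V_def card_image inj_on_def)
  have "(\<Prod>i\<in>UNIV. 2 * real (card (V i)) / \<sigma> i) = (2 / real T ^ (n + 1)) * (\<Prod>i\<in>UNIV - {i0}. 2 * real L)"
    by (subst prod.remove[of _ i0]) (auto simp: cardV \<sigma>_def intro!: prod.cong)
  also have "\<dots> = 2 ^ n * (real L ^ k / real T ^ (n + 1))"
    using card n by (simp add: card_Diff_singleton power_mult_distrib)
  finally have pr: "(\<Prod>i\<in>UNIV. 2 * real (card (V i)) / \<sigma> i) = 2 ^ n * (real L ^ k / real T ^ (n + 1))" .
  have "sobolev_norm s (wave \<sigma> V) \<le> ?R powr s * sqrt ((2 * pi) ^ CARD('n) * (2 + 3 * real CARD('n)) * (\<Prod>i\<in>UNIV. 2 * real (card (V i)) / \<sigma> i))"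
  proof (rule sobolev_norm_wave_le[OF \<sigma>_pos finite_V separated _ _ R1 s])
    show "\<sigma> i \<le> ?R" for i
    proof (cases "i = i0")
      case True
      have "real T ^ (n + 1) \<le> real T ^ (2 * n + 2)" using T_pos by (intro power_increasing) auto
      then show ?thesis using P True unfolding \<sigma>_def by simp
    next
      case False
      then show ?thesis using R1 unfolding \<sigma>_def by simp
    qed
    show "\<bar>v\<bar> \<le> ?R" if v: "v \<in> V i" for i v
    proof (cases "i = i0")
      case True
      then show ?thesis using v unfolding V_def by simp
    next
      case False
      then obtain l where l: "l < L" "v = 2 * pi * real T ^ (n + 2) * real l" using v unfolding V_def by auto
      have "real l \<le> real L" using l by simp
      also have "\<dots> \<le> real T ^ n" by (rule L_le)
      finally have "\<bar>v\<bar> \<le> 2 * pi * real T ^ (n + 2) * real T ^ n"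
        unfolding l(2) abs_mult by (intro mult_mono) auto
      also have "\<dots> = ?R"
      proof -
        have "n + 2 + n = 2 * n + 2" by simp
        then show ?thesis by (simp only: mult.assoc power_add[symmetric])
      qed
      finally show ?thesis .
    qed
  qed
  then show ?thesis
    unfolding pr card by (simp only: mult.assoc)
qed

text \<open>The ratio \<open>L / q\<close> is at least \<open>T / K\<close>, whereas the error in
  \<open>amp\<close> is logarithmic. The assumption \<open>T_large\<close> makes that error at most
  half of the main term, uniformly for \<open>q <= T ^ k\<close>.\<close>

lemma amp_ge:
  assumes q: "q \<in> large" and T_large: "5 / 2 * (3 + ln (4 * real T ^ k)) \<le> real T / (16 * real K)"
  shows "real L / (8 * sqrt (real T ^ k)) \<le> amp q"
proof -
  have q1: "q \<ge> 1" "q \<le> T ^ k" using q by (auto simp: large_def)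
  have qT: "real q \<le> real T ^ k" using q1 by (metis of_nat_le_iff of_nat_power)
  have "harm (4 * q) \<le> 1 + ln (real (4 * q))" using q1 by (intro harm_le_ln) simp
  also have "ln (real (4 * q)) \<le> ln (4 * real T ^ k)" using q1 qT by (intro ln_mono) auto
  finally have "5 / 2 * (2 + harm (4 * q)) \<le> real T / (16 * real K)" using T_large by simp
  also have "\<dots> = real L / (16 * real T ^ k)"
    unfolding L_real using T_pos by (simp add: n)
  also have "\<dots> \<le> real L / (16 * real q)"
    using qT q1 T_pos by (intro divide_left_mono) auto
  finally have "real L / (8 * real q) - real L / (16 * real q) \<le> real L / (8 * real q) - 5 / 2 * (2 + harm (4 * q))"
    by linarith
  moreover have "real L / (8 * real q) - real L / (16 * real q) = real L / (16 * real q)"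
    using q1 by (simp add: field_simps)
  ultimately have "sqrt (8 * real q) * (real L / (16 * real q)) \<le> amp q"
    unfolding amp_def by (intro mult_left_mono) auto
  moreover have "real L / (8 * sqrt (real T ^ k)) \<le> sqrt (8 * real q) * (real L / (16 * real q))"
  proof -
    have "real L / (8 * sqrt (real T ^ k)) \<le> real L / (8 * sqrt (real q))"
      using qT q1 T_pos by (intro divide_left_mono mult_left_mono real_sqrt_le_mono) auto
    also have "\<dots> = 2 * sqrt (real q) * (real L / (16 * real q))"
      using q1 real_sqrt_mult_self[of "real q"] by (simp add: field_simps)
    also have "\<dots> \<le> sqrt (8 * real q) * (real L / (16 * real q))"
    proof -
      have "2 * sqrt (real q) = sqrt (4 * real q)" by (simp add: real_sqrt_mult)
      then show ?thesis by (intro mult_right_mono) auto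
    qed
    finally show ?thesis .
  qed
  ultimately show ?thesis by linarith
qed

lemma totient_large_ge:
  assumes "q \<in> large"
  shows "2 * real T ^ k / (4 ^ k * (3 + real k * log 2 (real T))) \<le> real (totient (4 * q))"
proof -
  have q1: "q \<ge> 1" "q \<le> T ^ k" and ql: "real T ^ k \<le> 2 * 4 ^ k * real q" using assms by (auto simp: large_def)
  have qT: "real q \<le> real T ^ k" using q1 by (metis of_nat_le_iff of_nat_power)
  define B where "B = 3 + real k * log 2 (real T)"
  have lT: "0 \<le> log 2 (real T)" using T_pos by simp
  then have B0: "B > 0" unfolding B_def by (smt (verit) mult_nonneg_nonneg of_nat_0_le_iff)
  have "log 2 (real (4 * q)) \<le> log 2 (4 * real T ^ k)" using q1 qT by (intro log_mono) auto
  also have "\<dots> = 2 + real k * log 2 (real T)"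
  proof -
    have "log 2 (4::real) = 2" using log_pow_cancel[of "2::real" 2] by simp
    then show ?thesis using T_pos by (simp add: log_mult log_nat_power)
  qed
  finally have "1 + log 2 (real (4 * q)) \<le> B" by (simp add: B_def)
  then have "real (totient (4 * q)) * (1 + log 2 (real (4 * q))) \<le> real (totient (4 * q)) * B"
    by (intro mult_left_mono) auto
  with totient_ge[of "4 * q"] q1 have "real (4 * q) \<le> real (totient (4 * q)) * B" by linarith
  moreover have "2 * real T ^ k / 4 ^ k \<le> real (4 * q)" using ql by (simp add: field_simps)
  ultimately have "2 * real T ^ k / 4 ^ k \<le> real (totient (4 * q)) * B" by linarith
  then show ?thesis unfolding B_def[symmetric] using B0 by (simp add: field_simps)
qed

text \<open>In the measure factor \<open>M * \<phi> * \<tau>\<close> all powers of \<open>T\<close>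
  cancel and only the logarithmic factor survives. The remaining exponents are
  \<open>(n - k / 2) * k\<close> against \<open>(2 n + 2) * s + (n * k - n - 1) / 2\<close>, and for
  \<open>k = n - 1\<close> they differ by \<open>n - (2 n + 2) * s\<close>.\<close>

lemma growth_bound:
  assumes bound: "max_L1_ball (wave \<sigma> V) \<le> ennreal (C * sobolev_norm s (wave \<sigma> V))" and C: "C \<ge> 0"
    and s: "0 < s" "s < 1"
    and T_large: "5 / 2 * (3 + ln (4 * real T ^ k)) \<le> real T / (16 * real K)"
  shows "1 / (4 * real K ^ (k + 2) * 4 ^ k) * (1 / (8 * real K)) ^ k * real T powr (real n - (2 * real n + 2) * s)
    \<le> C * (2 * pi) powr s * sqrt ((2 * pi) ^ n * (2 + 3 * real n) * 2 ^ n / real K ^ k) * (3 + real k * log 2 (real T))"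
proof -
  define X where "X = real T"
  define \<kappa> where "\<kappa> = real K"
  define B where "B = 3 + real k * log 2 X"
  define H where "H = real L / (8 * sqrt (X ^ k))"
  define c where "c = (2 * pi) ^ n * (2 + 3 * real n) * 2 ^ n"
  define \<phi> where "\<phi> = 2 * X ^ k / (4 ^ k * B)"
  have X1: "X \<ge> 1" and X0: "X > 0" using T_pos by (auto simp: X_def)
  have K0: "\<kappa> > 0" using K_pos by (simp add: \<kappa>_def)
  have "0 \<le> log 2 X" using X1 by simp
  then have B0: "B > 0" unfolding B_def by (smt (verit) mult_nonneg_nonneg of_nat_0_le_iff)
  have c0: "c > 0" by (simp add: c_def)
  have L_eq: "real L = X ^ n / \<kappa>" using L_real by (simp add: X_def \<kappa>_def)
  have H0: "H \<ge> 0" using X0 by (simp add: H_def)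
  have "ennreal (1 / 2 * H ^ k * (real M * \<phi> * (\<tau> / \<kappa> ^ k / 2))) \<le> max_L1_ball (wave \<sigma> V)"
    unfolding \<kappa>_def using B0 X0
    by (intro max_L1_ball_ge H0 amp_ge[OF _ T_large, folded X_def, folded H_def]
        totient_large_ge[folded X_def, folded B_def, folded \<phi>_def]) (auto simp: \<phi>_def)
  also note bound
  also have "ennreal (C * sobolev_norm s (wave \<sigma> V)) \<le> ennreal (C * ((2 * pi * X ^ (2 * n + 2)) powr s * sqrt (c * (real L ^ k / X ^ (n + 1)))))"
    unfolding X_def c_def by (intro ennreal_leI mult_left_mono sobolev_norm_le s C)
  finally have main: "1 / 2 * H ^ k * (real M * \<phi> * (\<tau> / \<kappa> ^ k / 2)) \<le> C * ((2 * pi * X ^ (2 * n + 2)) powr s * sqrt (c * (real L ^ k / X ^ (n + 1))))"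
    using C c0 X0 by (subst (asm) ennreal_le_iff) auto
  have "real M = X\<^sup>2 / (2 * \<kappa>)"
    using arg_cong[OF M, of real] K0 by (simp add: X_def \<kappa>_def field_simps)
  moreover have "\<tau> = 1 / (\<kappa> * X ^ (k + 2))"
    unfolding \<tau>_def by (simp add: n X_def \<kappa>_def)
  ultimately have "real M * \<phi> * (\<tau> / \<kappa> ^ k / 2) = 1 / (2 * \<kappa> ^ (k + 2) * 4 ^ k * B)"
    using X0 K0 B0 by (simp add: \<phi>_def power_add power2_eq_square)
  moreover have "H ^ k = (1 / (8 * \<kappa>)) ^ k * X powr ((real n - real k / 2) * real k)"
  proof -
    have "sqrt (X ^ k) = X powr (real k / 2)"
      using X0 by (simp add: powr_half_sqrt[symmetric] powr_powr powr_realpow[symmetric])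
    then have "H = 1 / (8 * \<kappa>) * X powr (real n - real k / 2)"
      unfolding H_def L_eq using X0 by (simp add: powr_diff powr_realpow)
    then show ?thesis
      using X0 by (simp add: power_mult_distrib power_divide powr_powr powr_realpow[symmetric])
  qed
  ultimately have lhs: "1 / 2 * H ^ k * (real M * \<phi> * (\<tau> / \<kappa> ^ k / 2)) =
    1 / (4 * \<kappa> ^ (k + 2) * 4 ^ k) * (1 / (8 * \<kappa>)) ^ k * X powr ((real n - real k / 2) * real k) / B"
    by simp
  have "real L ^ k / X ^ (n + 1) = 1 / \<kappa> ^ k * X powr (real n * real k - (real n + 1))"
  proof -
    have "(X ^ n) ^ k = X powr (real n * real k)"
      using X0 by (simp add: powr_realpow[symmetric] powr_powr power_mult[symmetric])
    moreover have "X ^ (n + 1) = X powr (real n + 1)"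
      using X0 powr_realpow[of X "n + 1"] by (simp add: add.commute)
    ultimately show ?thesis
      unfolding L_eq power_divide powr_diff by simp
  qed
  then have "sqrt (c * (real L ^ k / X ^ (n + 1))) = sqrt (c / \<kappa> ^ k) * X powr ((real n * real k - (real n + 1)) / 2)"
    using X0 by (simp add: real_sqrt_mult real_sqrt_divide powr_half_sqrt[symmetric] powr_powr)
  moreover have "(2 * pi * X ^ (2 * n + 2)) powr s = (2 * pi) powr s * X powr ((2 * real n + 2) * s)"
  proof -
    have "X ^ (2 * n + 2) = X powr (2 * real n + 2)"
      using powr_realpow[OF X0, of "2 * n + 2"] by (simp only: of_nat_add of_nat_mult of_nat_numeral)
    then have "(2 * pi * X ^ (2 * n + 2)) powr s = (2 * pi * X powr (2 * real n + 2)) powr s" by (simp only:)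
    also have "\<dots> = (2 * pi) powr s * (X powr (2 * real n + 2)) powr s" by (rule powr_mult)
    finally show ?thesis by (simp only: powr_powr)
  qed
  ultimately have rhs: "C * ((2 * pi * X ^ (2 * n + 2)) powr s * sqrt (c * (real L ^ k / X ^ (n + 1)))) =
    C * (2 * pi) powr s * sqrt (c / \<kappa> ^ k) * X powr ((2 * real n + 2) * s + (real n * real k - (real n + 1)) / 2)"
    by (simp add: powr_add)
  define e1 where "e1 = (real n - real k / 2) * real k"
  define e2 where "e2 = (2 * real n + 2) * s + (real n * real k - (real n + 1)) / 2"
  have "1 / (4 * \<kappa> ^ (k + 2) * 4 ^ k) * (1 / (8 * \<kappa>)) ^ k * X powr e1 / B \<le> C * (2 * pi) powr s * sqrt (c / \<kappa> ^ k) * X powr e2"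
    using main unfolding lhs rhs e1_def e2_def .
  moreover have "a * (x / y) \<le> b * B" if "a * x / B \<le> b * y" "y > 0" for a b x y :: real
    using that B0 by (simp add: field_simps)
  moreover have "X powr e2 > 0" using X0 by simp
  ultimately have "1 / (4 * \<kappa> ^ (k + 2) * 4 ^ k) * (1 / (8 * \<kappa>)) ^ k * (X powr e1 / X powr e2) \<le> C * (2 * pi) powr s * sqrt (c / \<kappa> ^ k) * B"
    by blast
  moreover have "X powr e1 / X powr e2 = X powr (real n - (2 * real n + 2) * s)"
  proof -
    have "e1 - e2 = real n - (2 * real n + 2) * s"
      by (simp add: e1_def e2_def n field_simps)
    then show ?thesis using powr_diff[of X e1 e2] by simp
  qed
  ultimately show ?thesis
    unfolding X_def \<kappa>_def B_def c_def by simp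
qed

end

theorem theorem2:
  fixes s :: real
  assumes "CARD('n::finite) \<ge> 2"
    and "s > 0"
    and "\<exists>C::real. \<forall>f::real^'n \<Rightarrow> complex. f \<in> schwartz \<longrightarrow>
            max_L1_ball f \<le> ennreal (C * sobolev_norm s f)"
  shows "s \<ge> real CARD('n) / (2 * (real CARD('n) + 1))"
proof (rule ccontr)
  assume neg: "\<not> ?thesis"
  define n where "n = CARD('n)"
  define k where "k = n - 1"
  define K :: nat where "K = 64 * 4 ^ k"
  define \<epsilon> where "\<epsilon> = real n - (2 * real n + 2) * s"
  have lt: "s < real n / (2 * (real n + 1))" using neg by (simp add: n_def)
  have \<epsilon>: "\<epsilon> > 0" using lt by (simp add: \<epsilon>_def field_simps)
  have "real n / (2 * (real n + 1)) \<le> 1" by (simp add: field_simps)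
  \<comment> \<open>The Sobolev estimate is proved for \<open>s < 1\<close> only; the negated
    conclusion places \<open>s\<close> in that range.\<close>
  then have s1: "s < 1" using lt by linarith
  have nk: "n = Suc k" "k \<ge> 1" using assms(1) by (auto simp: n_def k_def)
  have K0: "real K > 0" by (simp add: K_def)
  obtain C' where C': "\<And>f::real^'n \<Rightarrow> complex. f \<in> schwartz \<Longrightarrow> max_L1_ball f \<le> ennreal (C' * sobolev_norm s f)"
    using assms(3) by blast
  \<comment> \<open>The given constant may be negative; \<open>growth_bound\<close> needs a
    nonnegative one.\<close>
  define C where "C = \<bar>C'\<bar>"
  have C: "max_L1_ball f \<le> ennreal (C * sobolev_norm s f)" if "f \<in> schwartz" for f :: "real^'n \<Rightarrow> complex"
  proof -
    have "0 \<le> sobolev_norm s f" unfolding sobolev_norm_def by (intro real_sqrt_ge_zero mult_nonneg_nonneg) auto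
    then have "C' * sobolev_norm s f \<le> C * sobolev_norm s f" unfolding C_def by (intro mult_right_mono) auto
    then show ?thesis using C'[OF that] ennreal_leI order_trans by blast
  qed
  define a where "a = 1 / (4 * real K ^ (k + 2) * 4 ^ k) * (1 / (8 * real K)) ^ k"
  define b where "b = C * (2 * pi) powr s * sqrt ((2 * pi) ^ n * (2 + 3 * real n) * 2 ^ n / real K ^ k)"
  have a0: "a > 0" using K0 by (simp add: a_def)
  have "filterlim (\<lambda>x::real. real K * x) at_top at_top" using K0 by real_asymp
  then have lim: "filterlim (\<lambda>u. real K * real u) at_top sequentially"
    by (rule filterlim_compose[OF _ filterlim_real_sequentially])
  have "\<forall>\<^sub>F x in at_top. 5 / 2 * (3 + (ln 4 + real k * ln x)) \<le> x / (16 * real K)"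
    using K0 by real_asymp
  moreover have "\<forall>\<^sub>F x in at_top. a * x powr \<epsilon> > b * (3 + real k * log 2 x)"
    using a0 \<epsilon> by real_asymp
  ultimately have "\<forall>\<^sub>F x in at_top. 5 / 2 * (3 + (ln 4 + real k * ln x)) \<le> x / (16 * real K) \<and> a * x powr \<epsilon> > b * (3 + real k * log 2 x)"
    by (rule eventually_conj)
  from eventually_conj[OF eventually_gt_at_top[of "0::nat"] eventually_compose_filterlim[OF this lim]]
  have "\<exists>u::nat. u > 0 \<and> 5 / 2 * (3 + (ln 4 + real k * ln (real K * real u))) \<le> (real K * real u) / (16 * real K)
     \<and> a * (real K * real u) powr \<epsilon> > b * (3 + real k * log 2 (real K * real u))"
    by (rule eventually_happens'[OF sequentially_bot])
  then obtain u :: nat where uu: "u > 0"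
    "5 / 2 * (3 + (ln 4 + real k * ln (real K * real u))) \<le> (real K * real u) / (16 * real K)"
    "a * (real K * real u) powr \<epsilon> > b * (3 + real k * log 2 (real K * real u))"
    by blast
  define T where "T = K * u"
  have TK: "real T = real K * real u" "real T > 0" using uu K0 by (auto simp: T_def)
  \<comment> \<open>These values solve the locale equations for \<open>T = K * u\<close>:
    \<open>K * u * T ^ k = T ^ n\<close>, and
    \<open>2 * K * 32 * 4 ^ k * u^2 = K^2 * u^2 = T^2\<close>. Any coordinate can be the
    longitudinal one, hence \<open>undefined\<close>.\<close>
  interpret bourgain T K n k "u * T ^ k" "32 * 4 ^ k * u\<^sup>2" u "undefined :: 'n"
    by unfold_locales
      (use nk uu in \<open>auto simp: n_def[symmetric] K_def T_def power2_eq_square algebra_simps\<close>)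
  have "a * real T powr \<epsilon> \<le> b * (3 + real k * log 2 (real T))"
    unfolding a_def b_def \<epsilon>_def
  proof (rule growth_bound[OF C _ assms(2) s1])
    show "wave \<sigma> V \<in> schwartz" by (rule wave_schwartz[OF \<sigma>_ge_1 finite_V])
    show "0 \<le> C" by (simp add: C_def)
    have "ln (4 * real T ^ k) = ln 4 + real k * ln (real T)"
      using TK(2) by (simp add: ln_mult ln_realpow)
    then show "5 / 2 * (3 + ln (4 * real T ^ k)) \<le> real T / (16 * real K)"
      using uu(2) unfolding TK(1)[symmetric] by simp
  qed
  then show False using uu(3) unfolding TK(1) by linarith
qed

end
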